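(* Let $W$ be a standard real-valued Brownian motion on $[0,1]$. Then $$\operatorname{Var}\left(\int_{0}^{1}W_{u}^{2}\,du\,\Big|\,W_{1},\int_{0}^{1}W_{u}\,du\right) = \frac{11}{6300} + \frac{1}{180}W_{1}^{2} + \frac{1}{175}\left(\int_{0}^{1}W_{u}\,du - \frac{1}{2}W_{1}\right)^{2}.$$
   Context: For a square-integrable random variable $X$ and random variables $Y_1,Y_2$, the conditional variance is $\operatorname{Var}(X\,|\,Y_1,Y_2)=\mathbb{E}\big[(X-\mathbb{E}[X|Y_1,Y_2])^2\,\big|\,Y_1,Y_2\big]$; the equality is almost sure. *)

theory Defs
  imports "HOL-Probability.Probability"
begin

text \<open>
  Every path is required to be continuous, rather than almost every path: over a probability space
  that need not be complete, this is what makes the path integrals measurable.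
  Degenerate increments (equal times) are allowed in the partitions; they are constantly zero.
  The values of W outside of the index set [0,1] are irrelevant.
\<close>

locale standard_brownian_motion = prob_space M for M :: "'a measure" +
  fixes W :: "real \<Rightarrow> 'a \<Rightarrow> real"
  assumes random_variable_W: "t \<in> {0..1} \<Longrightarrow> random_variable borel (W t)"
    and starts_at_0: "AE \<omega> in M. W 0 \<omega> = 0"
    and indep_increments:
      "mono_on {..n} \<tau> \<Longrightarrow> \<tau> ` {..n} \<subseteq> {0..1} \<Longrightarrow>
        indep_vars (\<lambda>_. borel) (\<lambda>i \<omega>. W (\<tau> (Suc i)) \<omega> - W (\<tau> i) \<omega>) {..<n::nat}"
    and normal_increments:
      "0 \<le> s \<Longrightarrow> s < t \<Longrightarrow> t \<le> 1 \<Longrightarrow>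
        distributed M lborel (\<lambda>\<omega>. W t \<omega> - W s \<omega>) (normal_density 0 (sqrt (t - s)))"
    and continuous_paths: "\<omega> \<in> space M \<Longrightarrow> continuous_on {0..1} (\<lambda>t. W t \<omega>)"

definition sigma_gen2 :: "'a measure \<Rightarrow> ('a \<Rightarrow> real) \<Rightarrow> ('a \<Rightarrow> real) \<Rightarrow> 'a measure" where
  "sigma_gen2 M Y1 Y2 = vimage_algebra (space M) (\<lambda>\<omega>. (Y1 \<omega>, Y2 \<omega>)) (borel \<Otimes>\<^sub>M borel)"

definition cond_variance ::
  "'a measure \<Rightarrow> ('a \<Rightarrow> real) \<Rightarrow> ('a \<Rightarrow> real) \<Rightarrow> ('a \<Rightarrow> real) \<Rightarrow> 'a \<Rightarrow> real" where
  "cond_variance M X Y1 Y2 =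
    real_cond_exp M (sigma_gen2 M Y1 Y2)
      (\<lambda>\<omega>. (X \<omega> - real_cond_exp M (sigma_gen2 M Y1 Y2) X \<omega>)\<^sup>2)"

end

theory Submission
  imports Defs
begin

text \<open>
  Split the path at each time \<open>u\<close> into its best linear prediction from the end point \<open>W\<^sub>1\<close> and the area, and
  a remainder: \<open>W\<^sub>u = m\<^sub>u + R\<^sub>u\<close> with \<open>m\<^sub>u = u W\<^sub>1 + 6 u (1 - u) H\<close>, where \<open>H\<close> is the area minus \<open>W\<^sub>1 / 2\<close>, that
  is, the area under the Brownian bridge \<open>W\<^sub>u - u W\<^sub>1\<close>. The variables \<open>W\<^sub>1\<close> and \<open>H\<close> are independent with
  variances \<open>1\<close> and \<open>1/12\<close>, and \<open>R\<close> is Gaussian, independent of both, with covariance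
  \<open>K(u,v) = min u v - u v - 3 u (1 - u) v (1 - v)\<close>.

  Hence the integral of the squared path, minus its conditional mean, is the integral over \<open>u\<close> of
  \<open>D\<^sub>u = 2 m\<^sub>u R\<^sub>u + (R\<^sub>u\<^sup>2 - K(u,u))\<close>. Conditionally on the end point and the area the \<open>m\<^sub>u\<close> are constants, odd
  moments of \<open>R\<close> vanish, and the fourth moments of Gaussians give
  \<open>E[D\<^sub>u D\<^sub>v | W\<^sub>1, H] = 4 m\<^sub>u m\<^sub>v K(u,v) + 2 K(u,v)\<^sup>2\<close> (\<open>conditional_second_moment\<close>). Integrating over the unit
  square gives a quadratic polynomial in \<open>W\<^sub>1\<close> and \<open>H\<close>; its coefficients are integrals of piecewise polynomials
  (\<open>double_integrals\<close>), and the mixed one is zero.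

  By Fubini only two times \<open>u\<close>, \<open>v\<close> have to be considered together, so no Gaussian process is needed: it
  suffices that every linear combination of \<open>W\<^sub>1\<close>, \<open>H\<close>, \<open>W\<^sub>u\<close>, \<open>W\<^sub>v\<close> is normal (\<open>joint_normal\<close>). Such a combination
  is the Wiener integral of \<open>f = a + b (1/2 - x) + c 1[x < u] + d 1[x < v]\<close>, hence the limit of sums of
  independent increments weighted by the values of \<open>f\<close> on a grid, and its variance is the integral of \<open>f\<^sup>2\<close>
  (\<open>wsum_limit_normal\<close>). That uncorrelated jointly normal pairs are independent is read off from
  characteristic functions: the uniqueness theorem of Levy on the real line, applied one coordinate at
  a time, gives what is needed in higher dimension (\<open>indep_var_pairs_if_char_factors\<close>).
\<close>

section \<open>Uniqueness of Fourier transforms and independence\<close>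

lemma integral_distr_density:
  fixes p :: "'a \<Rightarrow> real" and g :: "real \<Rightarrow> 'b::{banach, second_countable_topology}"
  assumes [measurable]: "p \<in> borel_measurable M" "X \<in> borel_measurable M" "g \<in> borel_measurable borel"
    and "\<And>x. 0 \<le> p x"
  shows "(\<integral>x. g x \<partial>distr (density M p) borel X) = (\<integral>\<omega>. p \<omega> *\<^sub>R g (X \<omega>) \<partial>M)"
  using assms(4) by (simp add: integral_distr integral_density)

context prob_space
begin

lemma integrable_mult_bounded:
  fixes Z Y :: "'a \<Rightarrow> 'c::{real_normed_algebra,banach,second_countable_topology}"
  assumes "integrable M Z" and [measurable]: "Y \<in> borel_measurable M" and "\<And>\<omega>. norm (Y \<omega>) \<le> B"
  shows "integrable M (\<lambda>\<omega>. Z \<omega> * Y \<omega>)"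
proof (rule Bochner_Integration.integrable_bound)
  show "integrable M (\<lambda>\<omega>. norm (Z \<omega>) * B)" using assms(1) by auto
  show "AE \<omega> in M. norm (Z \<omega> * Y \<omega>) \<le> norm (norm (Z \<omega>) * B)"
  proof (rule AE_I2)
    fix \<omega>
    have "norm (Z \<omega> * Y \<omega>) \<le> norm (Z \<omega>) * norm (Y \<omega>)" by (rule norm_mult_ineq)
    also have "\<dots> \<le> norm (Z \<omega>) * B" using assms(3) by (intro mult_left_mono) auto
    finally show "norm (Z \<omega> * Y \<omega>) \<le> norm (norm (Z \<omega>) * B)" by simp
  qed
qed (use assms in measurable)

text \<open>
  The positive and the negative part of \<open>Z\<close>, used as densities, push forward under \<open>X\<close> to measures on the
  line with the same characteristic function. Both have the same mass, so after normalisation Levy's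
  uniqueness theorem identifies them.
\<close>

lemma integral_indicator_eq_0_real:
  fixes Z X :: "'a \<Rightarrow> real"
  assumes Z: "integrable M Z" and [measurable]: "X \<in> borel_measurable M"
    and ch: "\<And>t. (\<integral>\<omega>. of_real (Z \<omega>) * iexp (t * X \<omega>) \<partial>M) = 0"
    and [measurable]: "B \<in> sets borel"
  shows "(\<integral>\<omega>. Z \<omega> * indicator B (X \<omega>) \<partial>M) = 0"
proof -
  have [measurable]: "Z \<in> borel_measurable M" using Z by auto
  define P where "P \<omega> = max (Z \<omega>) 0" for \<omega>
  define N where "N \<omega> = max (- Z \<omega>) 0" for \<omega>
  have [measurable]: "P \<in> borel_measurable M" "N \<in> borel_measurable M"
    unfolding P_def N_def by auto
  have iP: "integrable M P" and iN: "integrable M N" unfolding P_def N_def using Z by auto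
  have ZPN: "Z \<omega> = P \<omega> - N \<omega>" for \<omega> by (auto simp: P_def N_def)
  have nn: "P \<omega> \<ge> 0" "N \<omega> \<ge> 0" for \<omega> by (auto simp: P_def N_def)
  define c where "c = (\<integral>\<omega>. P \<omega> \<partial>M)"
  \<comment> \<open>Frequency zero shows that both parts have the same mass.\<close>
  have "(\<integral>\<omega>. of_real (Z \<omega>) \<partial>M) = (0::complex)" using ch[of 0] by simp
  then have "(\<integral>\<omega>. Z \<omega> \<partial>M) = 0" by (metis integral_complex_of_real of_real_eq_0_iff)
  then have cN: "c = (\<integral>\<omega>. N \<omega> \<partial>M)" unfolding c_def ZPN using iP iN by simp
  have c0: "c \<ge> 0" unfolding c_def using nn by simp
  show ?thesis
  proof (cases "c = 0")
    case True
    have "AE \<omega> in M. P \<omega> = 0" "AE \<omega> in M. N \<omega> = 0"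
      using True cN integral_nonneg_eq_0_iff_AE[OF iP] integral_nonneg_eq_0_iff_AE[OF iN] nn
      by (simp_all add: c_def)
    then have "AE \<omega> in M. Z \<omega> * indicator B (X \<omega>) = 0" by eventually_elim (simp add: ZPN)
    then show ?thesis by (rule integral_eq_zero_AE)
  next
    case False
    with c0 have c: "c > 0" by simp
    have iexp_int: "integrable M (\<lambda>\<omega>. of_real (Q \<omega>) * iexp (t * X \<omega>))"
      if "integrable M Q" for Q :: "'a \<Rightarrow> real" and t
      using that by (intro integrable_mult_bounded[where B=1]) (auto)
    define D where "D Q = distr (density M (\<lambda>\<omega>. ennreal (Q \<omega> / c))) borel X" for Q :: "'a \<Rightarrow> real"
    have rd: "real_distribution (D Q)"
      if i: "integrable M Q" and q: "\<And>\<omega>. 0 \<le> Q \<omega>" "(\<integral>\<omega>. Q \<omega> \<partial>M) = c" for Q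
    proof -
      have [measurable]: "Q \<in> borel_measurable M" using i by auto
      interpret p: prob_space "density M (\<lambda>\<omega>. ennreal (Q \<omega> / c))"
      proof
        have "emeasure (density M (\<lambda>\<omega>. ennreal (Q \<omega> / c))) (space M) = (\<integral>\<^sup>+\<omega>. ennreal (Q \<omega> / c) \<partial>M)"
          by (auto simp: emeasure_density intro!: nn_integral_cong)
        also have "\<dots> = ennreal (\<integral>\<omega>. Q \<omega> / c \<partial>M)"
          using i q c by (intro nn_integral_eq_integral) auto
        also have "\<dots> = 1" using i q c by simp
        finally show "emeasure (density M (\<lambda>\<omega>. ennreal (Q \<omega> / c))) (space (density M (\<lambda>\<omega>. ennreal (Q \<omega> / c)))) = 1"
          by simp
      qed
      show ?thesis unfolding D_def by (rule p.real_distribution_distr) simp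
    qed
    have intD: "(\<integral>x. g x \<partial>D Q) = (\<integral>\<omega>. (Q \<omega> / c) *\<^sub>R g (X \<omega>) \<partial>M)"
      if i: "integrable M Q" and q: "\<And>\<omega>. 0 \<le> Q \<omega>" and g: "g \<in> borel_measurable borel"
      for Q and g :: "real \<Rightarrow> 'c::{banach, second_countable_topology}"
      unfolding D_def using i q g c by (intro integral_distr_density) auto
    have "char (D P) = char (D N)"
    proof
      fix t
      have "(\<integral>\<omega>. of_real (P \<omega>) * iexp (t * X \<omega>) \<partial>M) - (\<integral>\<omega>. of_real (N \<omega>) * iexp (t * X \<omega>) \<partial>M) = 0"
        using ch[of t] Bochner_Integration.integral_diff[OF iexp_int[OF iP, of t] iexp_int[OF iN, of t]]
        by (simp only: ZPN of_real_diff left_diff_distrib)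
      moreover have "char (D Q) t = (\<integral>\<omega>. of_real (Q \<omega>) * iexp (t * X \<omega>) \<partial>M) / c"
        if "integrable M Q" "\<And>\<omega>. 0 \<le> Q \<omega>" for Q
        unfolding char_def using that by (subst intD) (auto simp: scaleR_conv_of_real)
      ultimately show "char (D P) t = char (D N) t" using iP iN nn by simp
    qed
    then have "D P = D N"
      using iP iN nn cN c_def by (intro Levy_uniqueness rd) auto
    then have "(\<integral>x. indicator B x \<partial>D P) = (\<integral>x. indicator B x \<partial>D N :: real)" by simp
    then have "(\<integral>\<omega>. (P \<omega> / c) *\<^sub>R (indicator B (X \<omega>) :: real) \<partial>M) = (\<integral>\<omega>. (N \<omega> / c) *\<^sub>R indicator B (X \<omega>) \<partial>M)"
      using iP iN nn by (simp only: intD borel_measurable_indicator \<open>B \<in> sets borel\<close>)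
    then have "(\<integral>\<omega>. P \<omega> * indicator B (X \<omega>) \<partial>M) = (\<integral>\<omega>. N \<omega> * indicator B (X \<omega>) \<partial>M)"
      using c by simp
    moreover have "integrable M (\<lambda>\<omega>. Q \<omega> * indicator B (X \<omega>))" if "integrable M Q" for Q :: "'a \<Rightarrow> real"
      using that by (intro integrable_mult_bounded[where B=1]) (auto simp: indicator_def)
    ultimately show ?thesis using iP iN by (simp add: ZPN left_diff_distrib)
  qed
qed

text \<open>
  The hypothesis for all \<open>t\<close> passes to the complex conjugate of \<open>Z\<close> (replace \<open>t\<close> by \<open>- t\<close>), hence to the
  real and to the imaginary part.
\<close>

lemma integral_indicator_eq_0:
  fixes Z :: "'a \<Rightarrow> complex" and X :: "'a \<Rightarrow> real"
  assumes Z: "integrable M Z" and [measurable]: "X \<in> borel_measurable M"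
    and ch: "\<And>t. (\<integral>\<omega>. Z \<omega> * iexp (t * X \<omega>) \<partial>M) = 0"
    and [measurable]: "B \<in> sets borel"
  shows "(\<integral>\<omega>. Z \<omega> * indicator B (X \<omega>) \<partial>M) = 0"
proof -
  have iZ: "integrable M (\<lambda>\<omega>. Z \<omega> * iexp (t * X \<omega>))" for t
    using Z by (intro integrable_mult_bounded[where B=1]) auto
  have iC: "integrable M (\<lambda>\<omega>. cnj (Z \<omega>) * iexp (t * X \<omega>))" for t
    using Z by (intro integrable_mult_bounded[where B=1]) auto
  have cj: "(\<integral>\<omega>. cnj (Z \<omega>) * iexp (t * X \<omega>) \<partial>M) = 0" for t
  proof -
    have "(\<lambda>\<omega>. cnj (Z \<omega>) * iexp (t * X \<omega>)) = (\<lambda>\<omega>. cnj (Z \<omega> * iexp (- t * X \<omega>)))"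
      by (auto simp: exp_cnj)
    then have "(\<integral>\<omega>. cnj (Z \<omega>) * iexp (t * X \<omega>) \<partial>M) = cnj (\<integral>\<omega>. Z \<omega> * iexp (- t * X \<omega>) \<partial>M)"
      by (simp only: Bochner_Integration.integral_cnj)
    then show ?thesis by (simp only: ch complex_cnj_zero)
  qed
  have re: "(\<integral>\<omega>. of_real (Re (Z \<omega>)) * iexp (t * X \<omega>) \<partial>M) = 0" for t
  proof -
    have "(\<integral>\<omega>. of_real (Re (Z \<omega>)) * iexp (t * X \<omega>) \<partial>M)
      = (\<integral>\<omega>. (Z \<omega> * iexp (t * X \<omega>) + cnj (Z \<omega>) * iexp (t * X \<omega>)) / 2 \<partial>M)"
      by (intro Bochner_Integration.integral_cong refl)
        (simp add: complex_add_cnj flip: distrib_right)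
    also have "\<dots> = 0" using iZ iC ch cj by simp
    finally show ?thesis .
  qed
  have im: "(\<integral>\<omega>. of_real (Im (Z \<omega>)) * iexp (t * X \<omega>) \<partial>M) = 0" for t
  proof -
    have "of_real (Im z) * e = (z * e - cnj z * e) / (2 * \<i>)" for z e :: complex
    proof -
      have "of_real (Im z) = (z - cnj z) / (2 * \<i>)"
        unfolding complex_diff_cnj by (simp add: field_simps)
      then show ?thesis by (simp only: left_diff_distrib times_divide_eq_left)
    qed
    then have "(\<integral>\<omega>. of_real (Im (Z \<omega>)) * iexp (t * X \<omega>) \<partial>M)
      = (\<integral>\<omega>. (Z \<omega> * iexp (t * X \<omega>) - cnj (Z \<omega>) * iexp (t * X \<omega>)) / (2 * \<i>) \<partial>M)"
      by (simp only:)
    also have "\<dots> = 0" using iZ iC ch cj by simp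
    finally show ?thesis .
  qed
  have R: "(\<integral>\<omega>. Re (Z \<omega>) * indicator B (X \<omega>) \<partial>M) = 0"
    using Z re by (intro integral_indicator_eq_0_real) auto
  have I: "(\<integral>\<omega>. Im (Z \<omega>) * indicator B (X \<omega>) \<partial>M) = 0"
    using Z im by (intro integral_indicator_eq_0_real) auto
  have int: "integrable M (\<lambda>\<omega>. Z \<omega> * indicator B (X \<omega>))"
    using Z by (intro integrable_mult_bounded[where B=1]) (auto simp: indicator_def)
  have "Re (z * indicator B x) = Re z * indicator B x" "Im (z * indicator B x) = Im z * indicator B x"
    for z x by (auto simp: indicator_def)
  then show ?thesis
    using R I integral_Re[OF int] integral_Im[OF int] by (simp add: complex_eq_iff)
qed

text \<open>
  Allowing a complex weight makes the one-dimensional statement iterable: one exponential at a time is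
  traded for an indicator, while the other factors are part of the weight. This replaces a uniqueness
  theorem for characteristic functions in the plane.
\<close>

lemma integral_indicator2_eq_0:
  fixes Z :: "'a \<Rightarrow> complex" and X Y :: "'a \<Rightarrow> real"
  assumes Z: "integrable M Z" and [measurable]: "X \<in> borel_measurable M" "Y \<in> borel_measurable M"
    and ch: "\<And>s t. (\<integral>\<omega>. Z \<omega> * iexp (s * X \<omega> + t * Y \<omega>) \<partial>M) = 0"
    and [measurable]: "B \<in> sets borel" "C \<in> sets borel"
  shows "(\<integral>\<omega>. Z \<omega> * indicator B (X \<omega>) * indicator C (Y \<omega>) \<partial>M) = 0"
proof (rule integral_indicator_eq_0)
  show "integrable M (\<lambda>\<omega>. Z \<omega> * indicator B (X \<omega>))"
    using Z by (intro integrable_mult_bounded[where B=1]) (auto simp: indicator_def)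
  fix t
  have "(\<integral>\<omega>. (Z \<omega> * iexp (t * Y \<omega>)) * indicator B (X \<omega>) \<partial>M) = 0"
  proof (rule integral_indicator_eq_0)
    show "integrable M (\<lambda>\<omega>. Z \<omega> * iexp (t * Y \<omega>))"
      using Z by (intro integrable_mult_bounded[where B=1]) auto
    show "(\<integral>\<omega>. Z \<omega> * iexp (t * Y \<omega>) * iexp (s * X \<omega>) \<partial>M) = 0" for s
      using ch[of s t] by (simp add: exp_add algebra_simps)
  qed simp_all
  then show "(\<integral>\<omega>. Z \<omega> * indicator B (X \<omega>) * iexp (t * Y \<omega>) \<partial>M) = 0"
    by (simp add: mult_ac)
qed simp_all

text \<open>
  First the exponentials in the \<open>Y\<close>-pair become indicators, with weight the centred exponential of the
  \<open>X\<close>-pair; then those of the \<open>X\<close>-pair, with weight the centred indicator of the \<open>Y\<close>-pair. This yields the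
  product formula on rectangles, which form an intersection-stable generator.
\<close>

theorem indep_var_pairs_if_char_factors:
  fixes X1 X2 Y1 Y2 :: "'a \<Rightarrow> real"
  assumes [measurable]: "random_variable borel X1" "random_variable borel X2"
      "random_variable borel Y1" "random_variable borel Y2"
    and ch: "\<And>a b c d. expectation (\<lambda>\<omega>. iexp (a * X1 \<omega> + b * X2 \<omega> + (c * Y1 \<omega> + d * Y2 \<omega>)))
      = expectation (\<lambda>\<omega>. iexp (a * X1 \<omega> + b * X2 \<omega>)) * expectation (\<lambda>\<omega>. iexp (c * Y1 \<omega> + d * Y2 \<omega>))"
  shows "indep_var (borel \<Otimes>\<^sub>M borel) (\<lambda>\<omega>. (X1 \<omega>, X2 \<omega>)) (borel \<Otimes>\<^sub>M borel) (\<lambda>\<omega>. (Y1 \<omega>, Y2 \<omega>))"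
proof -
  let ?X = "\<lambda>\<omega>. (X1 \<omega>, X2 \<omega>)" and ?Y = "\<lambda>\<omega>. (Y1 \<omega>, Y2 \<omega>)"
  let ?G = "\<lambda>X. {X -` (B \<times> C) \<inter> space M | B C. B \<in> sets borel \<and> C \<in> sets borel} :: 'a set set"
  have int1: "integrable M (\<lambda>\<omega>. indicator B (X \<omega>) * indicator C (Y \<omega>) :: complex)"
    if [measurable]: "X \<in> borel_measurable M" "Y \<in> borel_measurable M" "B \<in> sets borel" "C \<in> sets borel"
    for X Y :: "'a \<Rightarrow> real" and B C
    by (rule integrable_const_bound[where B=1]) (auto simp: indicator_def)
  have prod_prob: "prob ((?X -` (B1 \<times> B2) \<inter> space M) \<inter> (?Y -` (C1 \<times> C2) \<inter> space M))
      = prob (?X -` (B1 \<times> B2) \<inter> space M) * prob (?Y -` (C1 \<times> C2) \<inter> space M)"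
    if [measurable]: "B1 \<in> sets borel" "B2 \<in> sets borel" "C1 \<in> sets borel" "C2 \<in> sets borel"
    for B1 B2 C1 C2
  proof -
    define IX where "IX \<omega> = (indicator B1 (X1 \<omega>) * indicator B2 (X2 \<omega>) :: complex)" for \<omega>
    define IY where "IY \<omega> = (indicator C1 (Y1 \<omega>) * indicator C2 (Y2 \<omega>) :: complex)" for \<omega>
    have iX: "integrable M IX" and iY: "integrable M IY" unfolding IX_def IY_def by (simp_all add: int1)
    have [measurable]: "IX \<in> borel_measurable M" "IY \<in> borel_measurable M" using iX iY by auto
    have bX: "norm (IX \<omega>) \<le> 1" and bY: "norm (IY \<omega>) \<le> 1" for \<omega>
      by (auto simp: IX_def IY_def indicator_def)
    have ie: "integrable M (\<lambda>\<omega>. iexp (f \<omega>))" if [measurable]: "f \<in> borel_measurable M" for f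
      by (rule integrable_const_bound[where B=1]) auto
    have 1: "expectation (\<lambda>\<omega>. iexp (a * X1 \<omega> + b * X2 \<omega>) * IY \<omega>)
        = expectation (\<lambda>\<omega>. iexp (a * X1 \<omega> + b * X2 \<omega>)) * expectation IY" for a b
    proof -
      define \<phi> where "\<phi> = expectation (\<lambda>\<omega>. iexp (a * X1 \<omega> + b * X2 \<omega>))"
      define Z where "Z \<omega> = iexp (a * X1 \<omega> + b * X2 \<omega>) - \<phi>" for \<omega>
      have iZ: "integrable M Z" unfolding Z_def by (intro Bochner_Integration.integrable_diff ie) auto
      have "(\<integral>\<omega>. Z \<omega> * indicator C1 (Y1 \<omega>) * indicator C2 (Y2 \<omega>) \<partial>M) = 0"
      proof (rule integral_indicator2_eq_0[OF iZ])
        fix s t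
        have "(\<integral>\<omega>. Z \<omega> * iexp (s * Y1 \<omega> + t * Y2 \<omega>) \<partial>M)
          = (\<integral>\<omega>. iexp (a * X1 \<omega> + b * X2 \<omega> + (s * Y1 \<omega> + t * Y2 \<omega>)) - \<phi> * iexp (s * Y1 \<omega> + t * Y2 \<omega>) \<partial>M)"
          by (intro Bochner_Integration.integral_cong refl) (simp add: Z_def algebra_simps exp_add)
        also have "\<dots> = (\<integral>\<omega>. iexp (a * X1 \<omega> + b * X2 \<omega> + (s * Y1 \<omega> + t * Y2 \<omega>)) \<partial>M)
             - (\<integral>\<omega>. \<phi> * iexp (s * Y1 \<omega> + t * Y2 \<omega>) \<partial>M)"
          by (intro Bochner_Integration.integral_diff integrable_mult_right ie) auto
        also have "\<dots> = 0" unfolding ch \<phi>_def by simp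
        finally show "(\<integral>\<omega>. Z \<omega> * iexp (s * Y1 \<omega> + t * Y2 \<omega>) \<partial>M) = 0" .
      qed simp_all
      moreover have i1: "integrable M (\<lambda>\<omega>. iexp (a * X1 \<omega> + b * X2 \<omega>) * IY \<omega>)"
        by (intro integrable_mult_bounded[OF ie _ bY]) measurable
      moreover have i2: "integrable M (\<lambda>\<omega>. \<phi> * IY \<omega>)" using iY by simp
      moreover have "(\<lambda>\<omega>. Z \<omega> * indicator C1 (Y1 \<omega>) * indicator C2 (Y2 \<omega>))
          = (\<lambda>\<omega>. iexp (a * X1 \<omega> + b * X2 \<omega>) * IY \<omega> - \<phi> * IY \<omega>)"
        by (auto simp: Z_def IY_def algebra_simps)
      ultimately have "(\<integral>\<omega>. iexp (a * X1 \<omega> + b * X2 \<omega>) * IY \<omega> \<partial>M) - (\<integral>\<omega>. \<phi> * IY \<omega> \<partial>M) = 0"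
        using Bochner_Integration.integral_diff[OF i1 i2] by (simp only:)
      then show ?thesis by (simp add: \<phi>_def)
    qed
    define Z where "Z \<omega> = IY \<omega> - expectation IY" for \<omega>
    have iZ: "integrable M Z" unfolding Z_def using iY by auto
    have "(\<integral>\<omega>. Z \<omega> * indicator B1 (X1 \<omega>) * indicator B2 (X2 \<omega>) \<partial>M) = 0"
    proof (rule integral_indicator2_eq_0[OF iZ])
      fix s t
      have "(\<integral>\<omega>. Z \<omega> * iexp (s * X1 \<omega> + t * X2 \<omega>) \<partial>M)
        = (\<integral>\<omega>. iexp (s * X1 \<omega> + t * X2 \<omega>) * IY \<omega> - expectation IY * iexp (s * X1 \<omega> + t * X2 \<omega>) \<partial>M)"
        by (intro Bochner_Integration.integral_cong refl) (simp add: Z_def algebra_simps)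
      also have "\<dots> = (\<integral>\<omega>. iexp (s * X1 \<omega> + t * X2 \<omega>) * IY \<omega> \<partial>M) - (\<integral>\<omega>. expectation IY * iexp (s * X1 \<omega> + t * X2 \<omega>) \<partial>M)"
        by (intro Bochner_Integration.integral_diff integrable_mult_right ie
            integrable_mult_bounded[where B=1] bY) auto
      also have "\<dots> = 0" unfolding 1 by simp
      finally show "(\<integral>\<omega>. Z \<omega> * iexp (s * X1 \<omega> + t * X2 \<omega>) \<partial>M) = 0" .
    qed simp_all
    moreover have i1: "integrable M (\<lambda>\<omega>. IX \<omega> * IY \<omega>)"
      by (intro integrable_mult_bounded[OF iX _ bY]) measurable
    moreover have i2: "integrable M (\<lambda>\<omega>. expectation IY * IX \<omega>)" using iX by simp
    moreover have "(\<lambda>\<omega>. Z \<omega> * indicator B1 (X1 \<omega>) * indicator B2 (X2 \<omega>)) = (\<lambda>\<omega>. IX \<omega> * IY \<omega> - expectation IY * IX \<omega>)"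
      by (auto simp: Z_def IX_def algebra_simps)
    ultimately have "(\<integral>\<omega>. IX \<omega> * IY \<omega> \<partial>M) - (\<integral>\<omega>. expectation IY * IX \<omega> \<partial>M) = 0"
      using Bochner_Integration.integral_diff[OF i1 i2] by (simp only:)
    then have main: "(\<integral>\<omega>. IX \<omega> * IY \<omega> \<partial>M) = expectation IX * expectation IY" by simp
    let ?EX = "?X -` (B1 \<times> B2) \<inter> space M" and ?EY = "?Y -` (C1 \<times> C2) \<inter> space M"
    have [measurable]: "?EX \<in> events" "?EY \<in> events" by measurable
    have ind: "(\<integral>\<omega>. complex_of_real (indicator E \<omega>) \<partial>M) = of_real (prob E)" if "E \<in> events" for E
      using that by (subst integral_complex_of_real) simp
    have "expectation IX = (\<integral>\<omega>. complex_of_real (indicator ?EX \<omega>) \<partial>M)"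
      by (intro Bochner_Integration.integral_cong) (auto simp: IX_def indicator_def)
    moreover have "expectation IY = (\<integral>\<omega>. complex_of_real (indicator ?EY \<omega>) \<partial>M)"
      by (intro Bochner_Integration.integral_cong) (auto simp: IY_def indicator_def)
    moreover have "(\<integral>\<omega>. IX \<omega> * IY \<omega> \<partial>M) = (\<integral>\<omega>. complex_of_real (indicator (?EX \<inter> ?EY) \<omega>) \<partial>M)"
      by (intro Bochner_Integration.integral_cong) (auto simp: IX_def IY_def indicator_def)
    ultimately have "complex_of_real (prob (?EX \<inter> ?EY)) = of_real (prob ?EX * prob ?EY)"
      using main ind[OF \<open>?EX \<in> events\<close>] ind[OF \<open>?EY \<in> events\<close>]
        ind[OF sets.Int[OF \<open>?EX \<in> events\<close> \<open>?EY \<in> events\<close>]]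
      by (simp only: of_real_mult)
    then show ?thesis by (simp only: of_real_eq_iff)
  qed
  have st: "Int_stable (?G X)" for X :: "'a \<Rightarrow> real \<times> real"
  proof (rule Int_stableI, safe)
    fix B C B' C' :: "real set"
    assume "B \<in> sets borel" "C \<in> sets borel" "B' \<in> sets borel" "C' \<in> sets borel"
    then show "\<exists>Ba Ca. X -` (B \<times> C) \<inter> space M \<inter> (X -` (B' \<times> C') \<inter> space M) = X -` (Ba \<times> Ca) \<inter> space M \<and> Ba \<in> sets borel \<and> Ca \<in> sets borel"
      by (intro exI[of _ "B \<inter> B'"] exI[of _ "C \<inter> C'"]) auto
  qed
  have "indep_set (?G ?X) (?G ?Y)"
  proof (rule indep_setI)
    have "X -` (B \<times> C) \<inter> space M \<in> events"
      if "X \<in> M \<rightarrow>\<^sub>M borel \<Otimes>\<^sub>M borel" "B \<in> sets borel" "C \<in> sets borel" for X :: "'a \<Rightarrow> real \<times> real" and B C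
      using that by (intro measurable_sets[OF that(1)] pair_measureI)
    moreover have "?X \<in> M \<rightarrow>\<^sub>M borel \<Otimes>\<^sub>M borel" "?Y \<in> M \<rightarrow>\<^sub>M borel \<Otimes>\<^sub>M borel" by measurable
    ultimately show "?G ?X \<subseteq> events" "?G ?Y \<subseteq> events" by blast+
    show "\<And>a b. a \<in> ?G ?X \<Longrightarrow> b \<in> ?G ?Y \<Longrightarrow> prob (a \<inter> b) = prob a * prob b"
      using prod_prob by auto
  qed
  then have "indep_set (sigma_sets (space M) (?G ?X)) (sigma_sets (space M) (?G ?Y))"
    by (intro indep_set_sigma_sets st)
  moreover have "sigma_sets (space M) (?G X) = sigma_sets (space M) {X -` A \<inter> space M | A. A \<in> sets (borel \<Otimes>\<^sub>M borel)}"
    for X :: "'a \<Rightarrow> real \<times> real"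
  proof -
    let ?E = "{a \<times> b | a b. a \<in> sets borel \<and> b \<in> sets borel} :: (real \<times> real) set set"
    have G: "?G X = {X -` A \<inter> space M | A. A \<in> ?E}"
      by blast
    have c: "{X -` A \<inter> space M | A. A \<in> sigma_sets UNIV ?E} = sigma_sets (space M) {X -` A \<inter> space M | A. A \<in> ?E}"
      by (rule sigma_sets_vimage_commute) simp
    have "sets (borel \<Otimes>\<^sub>M borel) = sigma_sets UNIV ?E"
      by (simp add: sets_pair_measure)
    then show ?thesis
      unfolding G by (simp only: c) (rule sigma_sets_sigma_sets_eq[symmetric], blast)
  qed
  ultimately have "indep_set (sigma_sets (space M) {?X -` A \<inter> space M | A. A \<in> sets (borel \<Otimes>\<^sub>M borel)})
      (sigma_sets (space M) {?Y -` A \<inter> space M | A. A \<in> sets (borel \<Otimes>\<^sub>M borel)})"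
    by (simp only:)
  moreover have "?X \<in> M \<rightarrow>\<^sub>M borel \<Otimes>\<^sub>M borel" "?Y \<in> M \<rightarrow>\<^sub>M borel \<Otimes>\<^sub>M borel" by measurable
  ultimately show ?thesis unfolding indep_var_eq by blast
qed

section \<open>Centred normal variables, possibly degenerate\<close>

text \<open>
  Normality is expressed by the characteristic function so that the variance \<open>v\<close> may vanish. Degenerate
  cases do occur: the residual is zero at both ends of the interval, and a difference of residuals is
  zero if the two times agree.
\<close>

definition centered_normal :: "('a \<Rightarrow> real) \<Rightarrow> real \<Rightarrow> bool" where
  "centered_normal Y v \<longleftrightarrow> random_variable borel Y \<and> 0 \<le> v \<and>
     (\<forall>t. expectation (\<lambda>\<omega>. iexp (t * Y \<omega>)) = of_real (exp (- (t\<^sup>2 * v / 2))))"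

lemma distr_centered_normal:
  assumes "centered_normal Y v"
  shows "distr M borel Y = distr std_normal_distribution borel (\<lambda>x. sqrt v * x)"
proof (rule Levy_uniqueness)
  interpret N: real_distribution std_normal_distribution by (rule real_dist_normal_dist)
  have [measurable]: "random_variable borel Y" and v: "0 \<le> v" using assms by (auto simp: centered_normal_def)
  show "real_distribution (distr M borel Y)" by simp
  show "real_distribution (distr std_normal_distribution borel (\<lambda>x. sqrt v * x))"
    by (rule N.real_distribution_distr) simp
  show "char (distr M borel Y) = char (distr std_normal_distribution borel (\<lambda>x. sqrt v * x))"
  proof
    fix t
    have "char (distr std_normal_distribution borel (\<lambda>x. sqrt v * x)) t = char std_normal_distribution (t * sqrt v)"
      by (simp add: char_def integral_distr mult_ac)
    also have "\<dots> = of_real (exp (- (t\<^sup>2 * v / 2)))"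
      using v by (simp add: char_std_normal_distribution power_mult_distrib)
    finally show "char (distr M borel Y) t = char (distr std_normal_distribution borel (\<lambda>x. sqrt v * x)) t"
      using assms by (simp add: char_def integral_distr centered_normal_def)
  qed
qed

lemma centered_normal_moments:
  assumes "centered_normal Y v"
  shows "integrable M (\<lambda>\<omega>. Y \<omega> ^ k)" "expectation Y = 0" "expectation (\<lambda>\<omega>. Y \<omega> ^ 2) = v"
    "expectation (\<lambda>\<omega>. Y \<omega> ^ 3) = 0" "expectation (\<lambda>\<omega>. Y \<omega> ^ 4) = 3 * v\<^sup>2"
proof -
  have [measurable]: "random_variable borel Y" and v: "0 \<le> v" using assms by (auto simp: centered_normal_def)
  have "integrable (distr M borel Y) (\<lambda>x. x ^ k)" for k
    unfolding distr_centered_normal[OF assms]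
    by (subst integrable_distr_eq) (auto simp: power_mult_distrib integrable_std_normal_distribution_moment)
  then show "integrable M (\<lambda>\<omega>. Y \<omega> ^ k)" by (subst (asm) integrable_distr_eq) auto
  have E: "expectation (\<lambda>\<omega>. Y \<omega> ^ k) = sqrt v ^ k * (\<integral>x. x ^ k \<partial>std_normal_distribution)" for k
  proof -
    have "expectation (\<lambda>\<omega>. Y \<omega> ^ k) = (\<integral>x. x ^ k \<partial>distr M borel Y)" by (simp add: integral_distr)
    also have "\<dots> = (\<integral>x. (sqrt v * x) ^ k \<partial>std_normal_distribution)"
      unfolding distr_centered_normal[OF assms] by (simp add: integral_distr)
    finally show ?thesis by (simp add: power_mult_distrib)
  qed
  show "expectation Y = 0" using E[of 1] integral_std_normal_distribution_moment_odd[of 1] by simp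
  show "expectation (\<lambda>\<omega>. Y \<omega> ^ 3) = 0" using E[of 3] integral_std_normal_distribution_moment_odd[of 3] by simp
  show "expectation (\<lambda>\<omega>. Y \<omega> ^ 2) = v"
    using E[of 2] std_normal_distribution_even_moments(1)[of 1] v by simp
  show "expectation (\<lambda>\<omega>. Y \<omega> ^ 4) = 3 * v\<^sup>2"
    using E[of 4] std_normal_distribution_even_moments(1)[of 2] v
    by (simp add: fact_numeral power4_eq_xxxx power2_eq_square)
qed

end

section \<open>Riemann sums for the uniform distribution on the unit interval\<close>

text \<open>
  Working with this probability measure on the whole line, rather than with integrals over a set, lets
  Fubini's theorem and the pair measures be used without carrying indicators along.
\<close>

definition unif01 :: "real measure" where
  "unif01 = density lborel (indicator {0..1})"

lemma space_unif01 [simp]: "space unif01 = UNIV" and sets_unif01 [simp, measurable_cong]: "sets unif01 = sets borel"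
  by (simp_all add: unif01_def)

interpretation unif01: prob_space unif01
  by standard (simp add: unif01_def emeasure_density)

lemma integral_unif01:
  fixes f :: "real \<Rightarrow> 'b::{banach, second_countable_topology}"
  assumes [measurable]: "f \<in> borel_measurable borel"
  shows "(\<integral>x. f x \<partial>unif01) = (LBINT x:{0..1}. f x)"
proof -
  have "(\<integral>x. f x \<partial>density lborel (\<lambda>x. ennreal (indicator {0..1} x))) = (LBINT x:{0..1}. f x)"
    by (subst integral_density) (auto simp: set_lebesgue_integral_def)
  moreover have "indicator {0..1} = (\<lambda>x::real. ennreal (indicator {0..1} x))"
    by (auto simp: indicator_def)
  ultimately show ?thesis by (simp add: unif01_def)
qed

lemma AE_unif01_iff: "(AE x in unif01. P x) \<longleftrightarrow> (AE x in lborel. x \<in> {0..1} \<longrightarrow> P x)"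
  unfolding unif01_def by (subst AE_density) (auto intro!: AE_cong simp: indicator_def)

lemma AE_unif01_neq: "AE x in unif01. x \<noteq> a"
  unfolding AE_unif01_iff using AE_lborel_singleton[of a] by eventually_elim simp

lemma AE_unif01_unit: "AE x in unif01. x \<in> {0<..<1}"
proof -
  have "AE x in unif01. x \<in> {0..1}" by (simp add: AE_unif01_iff)
  then show ?thesis using AE_unif01_neq[of 0] AE_unif01_neq[of 1] by eventually_elim auto
qed

lemma measure_unif01_cell:
  assumes "k < (n::nat)"
  shows "measure unif01 {real k / real n..<real (Suc k) / real n} = 1 / real n"
proof -
  have n: "real n > 0" using assms by simp
  have *: "real (Suc k) / real n \<le> 1" using assms n by (simp add: divide_le_eq)
  have "emeasure unif01 {real k / real n..<real (Suc k) / real n}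
      = emeasure lborel ({0..1} \<inter> {real k / real n..<real (Suc k) / real n})"
    by (simp add: unif01_def emeasure_density indicator_inter_arith[symmetric] nn_integral_indicator flip: indicator_inter_arith)
  also have "{0..1} \<inter> {real k / real n..<real (Suc k) / real n} = {real k / real n..<real (Suc k) / real n}"
  proof safe
    fix x assume x: "x \<in> {real k / real n..<real (Suc k) / real n}"
    have "0 \<le> real k / real n" by simp
    then show "x \<in> {0..1}" using x * order_trans[OF \<open>0 \<le> real k / real n\<close>, of x] by (auto simp del: of_nat_Suc)
  qed
  also have "emeasure lborel \<dots> = ennreal (1 / real n)"
    using n by (subst emeasure_lborel_Ico) (auto simp: field_simps intro!: divide_right_mono)
  finally show ?thesis using n by (simp add: measure_def)
qed

text \<open>
  With left end points as sample points, a Riemann sum of a function is the integral of its composition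
  with rounding down to the grid. The following two lemmas describe this rounding.
\<close>

lemma cell_iff_floor:
  assumes "0 \<le> x" "(n::nat) > 0"
  shows "x \<in> {real k / real n..<real (Suc k) / real n} \<longleftrightarrow> k = nat \<lfloor>real n * x\<rfloor>"
proof -
  have "x \<in> {real k / real n..<real (Suc k) / real n} \<longleftrightarrow> real k \<le> real n * x \<and> real n * x < real k + 1"
    using assms by (simp add: field_simps)
  also have "\<dots> \<longleftrightarrow> \<lfloor>real n * x\<rfloor> = int k" by (simp add: floor_eq_iff)
  also have "\<dots> \<longleftrightarrow> k = nat \<lfloor>real n * x\<rfloor>" using assms by auto
  finally show ?thesis .
qed

lemma floor_grid_tendsto: "(\<lambda>n. real_of_int \<lfloor>real n * x\<rfloor> / real n) \<longlonglongrightarrow> x"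
proof (rule real_tendsto_sandwich)
  show "\<forall>\<^sub>F n in sequentially. x - 1 / real n \<le> real_of_int \<lfloor>real n * x\<rfloor> / real n"
    using eventually_gt_at_top[of 0]
  proof eventually_elim
    case (elim n)
    have "real n * x - 1 \<le> real_of_int \<lfloor>real n * x\<rfloor>" by linarith
    then have "(real n * x - 1) / real n \<le> real_of_int \<lfloor>real n * x\<rfloor> / real n"
      by (intro divide_right_mono) auto
    then show ?case using elim by (simp add: diff_divide_distrib)
  qed
  show "\<forall>\<^sub>F n in sequentially. real_of_int \<lfloor>real n * x\<rfloor> / real n \<le> x"
    using eventually_gt_at_top[of 0]
  proof eventually_elim
    case (elim n)
    have "real_of_int \<lfloor>real n * x\<rfloor> \<le> real n * x" by linarith
    then show ?case using elim by (simp add: field_simps)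
  qed
  show "(\<lambda>n. x - 1 / real n) \<longlonglongrightarrow> x"
    using tendsto_diff[OF tendsto_const lim_1_over_n[where 'a=real], of x] by simp
qed simp

text \<open>
  Rounding down to the grid converges to the identity, so dominated convergence applies to the step
  functions. Continuity almost everywhere is enough, which covers integrands that jump at a given time.
\<close>

lemma riemann_sum_tendsto:
  fixes g :: "real \<Rightarrow> real"
  assumes [measurable]: "g \<in> borel_measurable borel" and B: "\<And>x. x \<in> {0..1} \<Longrightarrow> \<bar>g x\<bar> \<le> B"
    and cont: "AE x in unif01. isCont g x"
  shows "(\<lambda>n. (\<Sum>k<n. g (real k / real n)) / real n) \<longlonglongrightarrow> (\<integral>x. g x \<partial>unif01)"
proof -
  define s where "s n x = g (real_of_int \<lfloor>real n * x\<rfloor> / real n)" for n :: nat and x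
  have [measurable]: "s n \<in> borel_measurable borel" for n unfolding s_def by measurable
  have "(\<lambda>n. \<integral>x. s n x \<partial>unif01) \<longlonglongrightarrow> (\<integral>x. g x \<partial>unif01)"
  proof (rule integral_dominated_convergence[where w="\<lambda>_. B"])
    show "AE x in unif01. (\<lambda>n. s n x) \<longlonglongrightarrow> g x"
      using cont
      by eventually_elim (auto simp: s_def intro!: isCont_tendsto_compose[of _ g] floor_grid_tendsto)
    show "AE x in unif01. norm (s n x) \<le> B" for n
      using AE_unif01_unit
    proof eventually_elim
      case (elim x)
      have "real_of_int \<lfloor>real n * x\<rfloor> / real n \<in> {0..1}"
      proof (cases "n = 0")
        case False
        have "real_of_int \<lfloor>real n * x\<rfloor> \<le> real n * x" by linarith
        also have "\<dots> \<le> real n" using elim by (simp add: mult_left_le)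
        finally show ?thesis using False elim by (simp add: divide_le_eq)
      qed simp
      then show ?case unfolding s_def using B by simp
    qed
  qed simp_all
  moreover have "\<forall>\<^sub>F n in sequentially. (\<integral>x. s n x \<partial>unif01) = (\<Sum>k<n. g (real k / real n)) / real n"
    using eventually_gt_at_top[of 0]
  proof eventually_elim
    case (elim n)
    let ?C = "\<lambda>k. {real k / real n..<real (Suc k) / real n}"
    have "(\<integral>x. s n x \<partial>unif01) = (\<integral>x. (\<Sum>k<n. g (real k / real n) * indicator (?C k) x) \<partial>unif01)"
    proof (rule integral_cong_AE)
      show "AE x in unif01. s n x = (\<Sum>k<n. g (real k / real n) * indicator (?C k) x)"
        using AE_unif01_unit
      proof eventually_elim
        case (elim x)
        have "\<lfloor>real n * x\<rfloor> < int n" using elim \<open>0 < n\<close> by (simp add: floor_less_iff)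
        then have lt: "nat \<lfloor>real n * x\<rfloor> < n" using elim \<open>0 < n\<close> by (simp add: nat_less_iff)
        have "(\<Sum>k<n. g (real k / real n) * indicator (?C k) x)
          = (\<Sum>k<n. if k = nat \<lfloor>real n * x\<rfloor> then g (real k / real n) else 0)"
          using elim \<open>0 < n\<close> cell_iff_floor[of x n]
          by (intro sum.cong refl) (simp add: indicator_def)
        also have "\<dots> = g (real (nat \<lfloor>real n * x\<rfloor>) / real n)" using lt by simp
        also have "\<dots> = s n x" using elim by (simp add: s_def)
        finally show ?case by simp
      qed
      show "(\<lambda>x. \<Sum>k<n. g (real k / real n) * indicator (?C k) x) \<in> borel_measurable unif01"
        by measurable
    qed measurable
    also have "\<dots> = (\<Sum>k<n. g (real k / real n) * measure unif01 (?C k))"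
      by (subst Bochner_Integration.integral_sum) (auto simp: less_top[symmetric])
    also have "\<dots> = (\<Sum>k<n. g (real k / real n)) / real n"
      by (auto simp only: sum_divide_distrib measure_unif01_cell lessThan_iff times_divide_eq_right
          mult_1_right intro!: sum.cong)
    finally show ?case .
  qed
  ultimately show ?thesis by (rule Lim_transform_eventually)
qed

section \<open>Path integrals of Brownian motion\<close>

context standard_brownian_motion
begin

text \<open>
  The path, extended to the whole line by its values at \<open>0\<close> and \<open>1\<close>: it is continuous everywhere and
  coincides with \<open>W\<close> on the unit interval.
\<close>

definition V :: "real \<Rightarrow> 'a \<Rightarrow> real" where
  "V t = W (max 0 (min 1 t))"

lemma V_eq: "t \<in> {0..1} \<Longrightarrow> V t = W t"
  by (simp add: V_def)

lemma V_measurable1 [measurable]: "V t \<in> borel_measurable M"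
  unfolding V_def by (rule random_variable_W) auto

lemma V_isCont: "\<omega> \<in> space M \<Longrightarrow> isCont (\<lambda>t. V t \<omega>) t"
proof -
  assume "\<omega> \<in> space M"
  then have "continuous_on UNIV (\<lambda>t. V t \<omega>)"
    unfolding V_def
    by (intro continuous_on_compose2[OF continuous_paths] continuous_intros) auto
  then show ?thesis by (simp add: continuous_on_eq_continuous_at)
qed

lemma V_path_measurable: "\<omega> \<in> space M \<Longrightarrow> (\<lambda>t. V t \<omega>) \<in> borel_measurable borel"
  using V_isCont by (intro borel_measurable_continuous_onI) (simp add: continuous_on_eq_continuous_at)

text \<open>
  A path that is sampled at the grid point below \<open>t\<close> is jointly measurable, as only countably many sample
  times occur; by continuity the sampled paths converge to the path itself.
\<close>

lemma V_measurable [measurable]: "case_prod V \<in> borel_measurable (borel \<Otimes>\<^sub>M M)"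
proof (rule borel_measurable_LIMSEQ_metric)
  fix n :: nat
  have "(\<lambda>p::real \<times> 'a. (\<lambda>k. V (real_of_int k / real n) (snd p)) \<lfloor>real n * fst p\<rfloor>) \<in> borel_measurable (borel \<Otimes>\<^sub>M M)"
    by (rule measurable_compose_countable) measurable
  then show "(\<lambda>p::real \<times> 'a. V (real_of_int \<lfloor>real n * fst p\<rfloor> / real n) (snd p)) \<in> borel_measurable (borel \<Otimes>\<^sub>M M)"
    by simp
next
  fix p :: "real \<times> 'a" assume "p \<in> space (borel \<Otimes>\<^sub>M M)"
  then show "(\<lambda>n. V (real_of_int \<lfloor>real n * fst p\<rfloor> / real n) (snd p)) \<longlonglongrightarrow> case_prod V p"
    by (auto simp: space_pair_measure split_beta intro!: isCont_tendsto_compose[OF V_isCont] floor_grid_tendsto)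
qed

lemma V_path_bounded: 
  assumes "\<omega> \<in> space M" obtains B where "\<And>t. \<bar>V t \<omega>\<bar> \<le> B"
proof -
  have "compact ((\<lambda>t. V t \<omega>) ` {0..1})"
    using V_isCont[OF assms] by (intro compact_continuous_image continuous_at_imp_continuous_on) auto
  then obtain B where B: "\<And>t. t \<in> {0..1} \<Longrightarrow> \<bar>V t \<omega>\<bar> \<le> B"
    using compact_imp_bounded bounded_iff by (metis imageI real_norm_def)
  have "\<bar>V t \<omega>\<bar> \<le> B" for t
    using B[of "max 0 (min 1 t)"] by (simp add: V_def)
  then show ?thesis by (rule that)
qed

text \<open>
  The area under the path.
\<close>

definition S :: "'a \<Rightarrow> real" where
  "S \<omega> = (\<integral>u. V u \<omega> \<partial>unif01)"

text \<open>
  The integral of the squared path, whose conditional variance is sought.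
\<close>

definition Q :: "'a \<Rightarrow> real" where
  "Q \<omega> = (\<integral>u. (V u \<omega>)\<^sup>2 \<partial>unif01)"

lemma S_measurable [measurable]: "S \<in> borel_measurable M"
  unfolding S_def by measurable

lemma Q_measurable [measurable]: "Q \<in> borel_measurable M"
  unfolding Q_def by measurable

lemma path_integral_eq:
  fixes g :: "real \<Rightarrow> real"
  assumes "\<omega> \<in> space M" and [measurable]: "g \<in> borel_measurable borel"
  shows "(LBINT u:{0..1}. g (W u \<omega>)) = (\<integral>u. g (V u \<omega>) \<partial>unif01)"
proof -
  note V_path_measurable[OF assms(1), measurable]
  have "(\<integral>u. g (V u \<omega>) \<partial>unif01) = (LBINT u:{0..1}. g (V u \<omega>))"
    by (rule integral_unif01) measurable
  also have "\<dots> = (LBINT u:{0..1}. g (W u \<omega>))"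
    by (intro set_lebesgue_integral_cong) (auto simp: V_eq)
  finally show ?thesis by simp
qed

lemma S_eq: "\<omega> \<in> space M \<Longrightarrow> (LBINT u:{0..1}. W u \<omega>) = S \<omega>"
  using path_integral_eq[of \<omega> "\<lambda>x. x"] by (simp add: S_def)

lemma Q_eq: "\<omega> \<in> space M \<Longrightarrow> (LBINT u:{0..1}. (W u \<omega>)\<^sup>2) = Q \<omega>"
  using path_integral_eq[of \<omega> "\<lambda>x. x\<^sup>2"] by (simp add: Q_def)

end

section \<open>Wiener integrals and joint normality\<close>

text \<open>
  The closed indicator is kept in the integrand, so that functions given by different formulas on both
  sides of a point are handled by adding two instances.
\<close>

lemma has_bochner_integral_unif01_FTC:
  fixes f :: "real \<Rightarrow> real"
  assumes ab: "0 \<le> a" "a \<le> b" "b \<le> 1"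
    and F: "\<And>x. (F has_real_derivative f x) (at x)" and f: "continuous_on UNIV f"
  shows "has_bochner_integral unif01 (\<lambda>x. indicator {a..b} x * f x) (F b - F a)"
proof -
  have [measurable]: "f \<in> borel_measurable borel" using f by (rule borel_measurable_continuous_onI)
  have eq: "indicator {0..1} x *\<^sub>R (indicator {a..b} x * f x) = indicator {a..b} x *\<^sub>R f x" for x
    using ab by (auto simp: indicator_def)
  have "compact (f ` {a..b})"
    using f by (intro compact_continuous_image) (auto intro: continuous_on_subset)
  then obtain B where B: "\<And>x. x \<in> {a..b} \<Longrightarrow> \<bar>f x\<bar> \<le> B"
    using compact_imp_bounded bounded_iff by (metis imageI real_norm_def)
  have "B \<ge> 0" using B[of a] ab by auto
  then have "integrable unif01 (\<lambda>x. indicator {a..b} x * f x)"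
    using B by (intro unif01.integrable_const_bound[where B=B]) (auto simp: indicator_def)
  moreover have "(\<integral>x. indicator {a..b} x * f x \<partial>unif01) = (LBINT x:{0..1}. indicator {a..b} x * f x)"
    by (rule integral_unif01) measurable
  moreover have "\<dots> = F b - F a"
    unfolding set_lebesgue_integral_def eq
    using ab f F
    by (intro integral_FTC_atLeastAtMost)
      (auto intro: continuous_on_subset has_field_derivative_at_within simp flip: has_real_derivative_iff_has_vector_derivative)
  ultimately show ?thesis by (simp add: has_bochner_integral_iff)
qed

text \<open>
  Summation by parts: it turns a sum of increments weighted by their index into the Riemann sum of the path.
\<close>

lemma sum_weighted_increments:
  fixes x :: "nat \<Rightarrow> real"
  shows "(\<Sum>k<n. real k * (x (Suc k) - x k)) = real n * x n - (x n - x 0) - (\<Sum>k<n. x k)"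
  by (induction n) (simp_all add: algebra_simps)

context standard_brownian_motion
begin

text \<open>
  The Riemann-Stieltjes sum of \<open>f\<close> against the path on the grid with mesh \<open>1 / n\<close>, an approximation of the
  Wiener integral of \<open>f\<close>.
\<close>

definition wsum :: "nat \<Rightarrow> (real \<Rightarrow> real) \<Rightarrow> 'a \<Rightarrow> real" where
  "wsum n f \<omega> = (\<Sum>k<n. f (real k / real n) * (V (real (Suc k) / real n) \<omega> - V (real k / real n) \<omega>))"

lemma wsum_measurable [measurable]: "wsum n f \<in> borel_measurable M"
  unfolding wsum_def by measurable

lemma char_increment:
  assumes "0 \<le> s" "s < t" "t \<le> 1"
  shows "expectation (\<lambda>\<omega>. iexp (c * (W t \<omega> - W s \<omega>))) = of_real (exp (- (c\<^sup>2 * (t - s) / 2)))"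
proof -
  define \<sigma> where "\<sigma> = sqrt (t - s)"
  have \<sigma>: "\<sigma> > 0" using assms by (simp add: \<sigma>_def)
  have d: "distributed M lborel (\<lambda>\<omega>. (W t \<omega> - W s \<omega> - 0) / \<sigma>) std_normal_density"
    using normal_increments[OF assms] normal_standard_normal_convert[OF \<sigma>, of _ 0] by (simp add: \<sigma>_def)
  have [measurable]: "W t \<in> borel_measurable M" "W s \<in> borel_measurable M"
    using assms by (auto intro!: random_variable_W)
  from d have dd: "distr M lborel (\<lambda>\<omega>. (W t \<omega> - W s \<omega> - 0) / \<sigma>) = std_normal_distribution"
    by (auto simp: distributed_def)
  have "char std_normal_distribution (c * \<sigma>) = expectation (\<lambda>\<omega>. iexp ((c * \<sigma>) * ((W t \<omega> - W s \<omega> - 0) / \<sigma>)))"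
    unfolding dd[symmetric] char_def by (subst integral_distr) simp_all
  also have "\<dots> = expectation (\<lambda>\<omega>. iexp (c * (W t \<omega> - W s \<omega>)))"
    using \<sigma> by simp
  finally show ?thesis
    using assms by (simp add: char_std_normal_distribution \<sigma>_def power_mult_distrib)
qed

lemma char_wsum:
  "expectation (\<lambda>\<omega>. iexp (t * wsum n f \<omega>)) = of_real (exp (- (t\<^sup>2 * ((\<Sum>k<n. (f (real k / real n))\<^sup>2) / real n) / 2)))"
proof (cases "n = 0")
  case True
  then show ?thesis by (simp add: wsum_def prob_space)
next
  case False
  define \<tau> where "\<tau> k = real k / real n" for k
  have \<tau>01: "\<tau> ` {..n} \<subseteq> {0..1}" using False by (auto simp: \<tau>_def divide_le_eq)
  have "mono_on {..n} \<tau>" using False by (auto simp: mono_on_def \<tau>_def intro!: divide_right_mono)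
  from indep_increments[OF this \<tau>01]
  have iv: "indep_vars (\<lambda>_. borel) (\<lambda>k \<omega>. f (real k / real n) * (W (\<tau> (Suc k)) \<omega> - W (\<tau> k) \<omega>)) {..<n}"
    by (rule indep_vars_compose2) measurable
  have in01: "real k / real n \<in> {0..1}" if "k \<le> n" for k
    using that False by (auto simp: divide_le_eq)
  have ws: "wsum n f = (\<lambda>\<omega>. \<Sum>k<n. f (real k / real n) * (W (\<tau> (Suc k)) \<omega> - W (\<tau> k) \<omega>))"
    using in01 unfolding wsum_def \<tau>_def
    by (intro ext sum.cong refl) (simp add: V_eq del: of_nat_Suc)
  have "expectation (\<lambda>\<omega>. iexp (t * wsum n f \<omega>)) = char (distr M borel (wsum n f)) t"
    by (simp add: char_def integral_distr)
  also have "\<dots> = (\<Prod>k<n. char (distr M borel (\<lambda>\<omega>. f (real k / real n) * (W (\<tau> (Suc k)) \<omega> - W (\<tau> k) \<omega>))) t)"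
    unfolding ws by (rule char_distr_sum[OF iv])
  also have "\<dots> = (\<Prod>k<n. of_real (exp (- (t\<^sup>2 * ((f (real k / real n))\<^sup>2 / real n) / 2))))"
  proof (intro prod.cong refl)
    fix k assume "k \<in> {..<n}"
    then have k: "k < n" by simp
    have 1: "0 \<le> \<tau> k" "\<tau> k < \<tau> (Suc k)" "\<tau> (Suc k) \<le> 1" "\<tau> (Suc k) - \<tau> k = 1 / real n"
      using k False by (auto simp: \<tau>_def divide_strict_right_mono divide_le_eq simp flip: diff_divide_distrib)
    have [measurable]: "W (\<tau> k) \<in> borel_measurable M" "W (\<tau> (Suc k)) \<in> borel_measurable M"
      using 1 by (auto intro!: random_variable_W)
    have "char (distr M borel (\<lambda>\<omega>. f (real k / real n) * (W (\<tau> (Suc k)) \<omega> - W (\<tau> k) \<omega>))) t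
      = expectation (\<lambda>\<omega>. iexp ((t * f (real k / real n)) * (W (\<tau> (Suc k)) \<omega> - W (\<tau> k) \<omega>)))"
      unfolding char_def by (subst integral_distr) (simp_all add: mult.assoc)
    also have "\<dots> = of_real (exp (- (t\<^sup>2 * ((f (real k / real n))\<^sup>2 / real n) / 2)))"
      unfolding char_increment[OF 1(1-3)] 1(4) by (simp add: power_mult_distrib)
    finally show "char (distr M borel (\<lambda>\<omega>. f (real k / real n) * (W (\<tau> (Suc k)) \<omega> - W (\<tau> k) \<omega>))) t
      = of_real (exp (- (t\<^sup>2 * ((f (real k / real n))\<^sup>2 / real n) / 2)))" .
  qed
  also have "\<dots> = of_real (exp (\<Sum>k<n. - (t\<^sup>2 * ((f (real k / real n))\<^sup>2 / real n) / 2)))"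
    by (simp only: exp_sum finite_lessThan of_real_prod)
  also have "(\<Sum>k<n. - (t\<^sup>2 * ((f (real k / real n))\<^sup>2 / real n) / 2)) = - (t\<^sup>2 * ((\<Sum>k<n. (f (real k / real n))\<^sup>2) / real n) / 2)"
    by (simp only: sum_negf sum_divide_distrib sum_distrib_left)
  finally show ?thesis .
qed

text \<open>
  The variances of the approximating sums are Riemann sums of \<open>f\<^sup>2\<close>, and characteristic functions pass to
  pointwise limits. Whenever the sums happen to converge, this gives the Ito isometry without
  constructing a stochastic integral.
\<close>

lemma wsum_limit_normal:
  assumes [measurable]: "f \<in> borel_measurable borel" "Y \<in> borel_measurable M"
    and B: "\<And>x. x \<in> {0..1} \<Longrightarrow> \<bar>f x\<bar> \<le> B" and cont: "AE x in unif01. isCont f x"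
    and lim: "AE \<omega> in M. (\<lambda>n. wsum n f \<omega>) \<longlonglongrightarrow> Y \<omega>"
  shows "centered_normal Y (\<integral>x. (f x)\<^sup>2 \<partial>unif01)"
  unfolding centered_normal_def
proof (intro conjI allI)
  fix t
  have "(\<lambda>n. expectation (\<lambda>\<omega>. iexp (t * wsum n f \<omega>))) \<longlonglongrightarrow> expectation (\<lambda>\<omega>. iexp (t * Y \<omega>))"
  proof (rule integral_dominated_convergence[where w="\<lambda>_. 1"])
    show "AE \<omega> in M. (\<lambda>n. iexp (t * wsum n f \<omega>)) \<longlonglongrightarrow> iexp (t * Y \<omega>)"
      using lim by eventually_elim (intro tendsto_intros)
  qed auto
  moreover have "(\<lambda>n. (\<Sum>k<n. (f (real k / real n))\<^sup>2) / real n) \<longlonglongrightarrow> (\<integral>x. (f x)\<^sup>2 \<partial>unif01)"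
  proof (rule riemann_sum_tendsto)
    show "\<bar>(f x)\<^sup>2\<bar> \<le> B\<^sup>2" if "x \<in> {0..1}" for x
      using B[OF that] by (simp add: abs_le_square_iff[symmetric])
    show "AE x in unif01. isCont (\<lambda>x. (f x)\<^sup>2) x"
      using cont by eventually_elim (intro continuous_intros)
  qed measurable
  then have "(\<lambda>n. complex_of_real (exp (- (t\<^sup>2 * ((\<Sum>k<n. (f (real k / real n))\<^sup>2) / real n) / 2))))
      \<longlonglongrightarrow> of_real (exp (- (t\<^sup>2 * (\<integral>x. (f x)\<^sup>2 \<partial>unif01) / 2)))"
    by (intro tendsto_intros) simp_all
  ultimately show "expectation (\<lambda>\<omega>. iexp (t * Y \<omega>)) = of_real (exp (- (t\<^sup>2 * (\<integral>x. (f x)\<^sup>2 \<partial>unif01) / 2)))"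
    unfolding char_wsum by (rule LIMSEQ_unique)
qed (auto intro!: integral_nonneg_AE)

lemma wsum_const: "(\<lambda>n. wsum n (\<lambda>x. 1) \<omega>) \<longlonglongrightarrow> V 1 \<omega> - V 0 \<omega>"
proof (rule tendsto_eventually)
  show "\<forall>\<^sub>F n in sequentially. wsum n (\<lambda>x. 1) \<omega> = V 1 \<omega> - V 0 \<omega>"
    using eventually_gt_at_top[of 0]
  proof eventually_elim
    case (elim n)
    have "wsum n (\<lambda>x. 1) \<omega> = (\<Sum>k<n. V (real (Suc k) / real n) \<omega> - V (real k / real n) \<omega>)"
      by (simp add: wsum_def)
    also have "\<dots> = V 1 \<omega> - V 0 \<omega>"
      using elim by (subst sum_lessThan_telescope[of "\<lambda>k. V (real k / real n) \<omega>"]) simp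
    finally show ?case .
  qed
qed

text \<open>
  The sum telescopes to the increment up to the first grid point not below \<open>u\<close>, which is minus the floor of
  \<open>- n u\<close>, divided by \<open>n\<close>.
\<close>

lemma wsum_indicator:
  assumes \<omega>: "\<omega> \<in> space M" and u: "u \<in> {0..1}"
  shows "(\<lambda>n. wsum n (indicator {..<u}) \<omega>) \<longlonglongrightarrow> V u \<omega> - V 0 \<omega>"
proof -
  have eq: "\<forall>\<^sub>F n in sequentially. V (- real_of_int \<lfloor>real n * (- u)\<rfloor> / real n) \<omega> - V 0 \<omega> = wsum n (indicator {..<u}) \<omega>"
    using eventually_gt_at_top[of 0]
  proof eventually_elim
    case (elim n)
    define m where "m = nat \<lceil>real n * u\<rceil>"
    have m: "real m = - real_of_int \<lfloor>real n * (- u)\<rfloor>"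
    proof -
      have "0 \<le> real n * u" using u by simp
      then have "0 \<le> \<lceil>real n * u\<rceil>" by linarith
      then have "real m = real_of_int \<lceil>real n * u\<rceil>" by (simp add: m_def)
      then show ?thesis by (simp add: ceiling_def)
    qed
    have "real n * u \<le> real n" using u by (simp add: mult_left_le)
    then have "\<lceil>real n * u\<rceil> \<le> int n" by (simp add: ceiling_le_iff)
    then have "m \<le> n" by (simp only: m_def nat_le_iff)
    have iff: "real k / real n < u \<longleftrightarrow> k < m" for k
    proof -
      have "real k / real n < u \<longleftrightarrow> real k < real n * u" using elim by (simp add: field_simps)
      also have "\<dots> \<longleftrightarrow> int k < \<lceil>real n * u\<rceil>" by (simp add: less_ceiling_iff)
      also have "\<dots> \<longleftrightarrow> k < m" by (auto simp: m_def)
      finally show ?thesis .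
    qed
    have "wsum n (indicator {..<u}) \<omega> = (\<Sum>k<n. if k < m then V (real (Suc k) / real n) \<omega> - V (real k / real n) \<omega> else 0)"
      unfolding wsum_def by (intro sum.cong refl) (simp add: indicator_def iff)
    also have "\<dots> = (\<Sum>k<m. V (real (Suc k) / real n) \<omega> - V (real k / real n) \<omega>)"
      using \<open>m \<le> n\<close> by (intro sum.mono_neutral_cong_right) auto
    also have "\<dots> = V (real m / real n) \<omega> - V 0 \<omega>"
      by (subst sum_lessThan_telescope[of "\<lambda>k. V (real k / real n) \<omega>"]) simp
    finally show ?case by (simp only: m)
  qed
  have "(\<lambda>n. - (real_of_int \<lfloor>real n * (- u)\<rfloor> / real n)) \<longlonglongrightarrow> - (- u)"
    by (intro tendsto_minus floor_grid_tendsto)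
  then have "(\<lambda>n. - real_of_int \<lfloor>real n * (- u)\<rfloor> / real n) \<longlonglongrightarrow> u" by simp
  then have "(\<lambda>n. V (- real_of_int \<lfloor>real n * (- u)\<rfloor> / real n) \<omega>) \<longlonglongrightarrow> V u \<omega>"
    by (rule isCont_tendsto_compose[OF V_isCont[OF \<omega>]])
  from Lim_transform_eventually[OF tendsto_diff[OF this tendsto_const] eq] show ?thesis .
qed

text \<open>
  Why \<open>1/2 - x\<close> is the integrand of the bridge area: integration by parts of the integral of \<open>1 - x\<close>
  against the path gives the area, and a constant integrand \<open>1/2\<close> contributes half of the end point.
\<close>

lemma wsum_area:
  assumes \<omega>: "\<omega> \<in> space M"
  shows "(\<lambda>n. wsum n (\<lambda>x. 1/2 - x) \<omega>) \<longlonglongrightarrow> S \<omega> - (V 1 \<omega> + V 0 \<omega>) / 2"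
proof -
  have eq: "\<forall>\<^sub>F n in sequentially. (\<Sum>k<n. V (real k / real n) \<omega>) / real n
      + (V 1 \<omega> - V 0 \<omega>) * (1 / real n) - (V 1 \<omega> + V 0 \<omega>) / 2 = wsum n (\<lambda>x. 1/2 - x) \<omega>"
    using eventually_gt_at_top[of 0]
  proof eventually_elim
    case (elim n)
    have "wsum n (\<lambda>x. 1/2 - x) \<omega> = (\<Sum>k<n. V (real (Suc k) / real n) \<omega> - V (real k / real n) \<omega>) / 2
       - (\<Sum>k<n. real k * (V (real (Suc k) / real n) \<omega> - V (real k / real n) \<omega>)) / real n"
      unfolding wsum_def sum_divide_distrib sum_subtractf[symmetric]
      by (intro sum.cong refl) (simp add: field_simps)
    also have "(\<Sum>k<n. V (real (Suc k) / real n) \<omega> - V (real k / real n) \<omega>) = V 1 \<omega> - V 0 \<omega>"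
      using elim by (subst sum_lessThan_telescope[of "\<lambda>k. V (real k / real n) \<omega>"]) simp
    also have "(\<Sum>k<n. real k * (V (real (Suc k) / real n) \<omega> - V (real k / real n) \<omega>))
        = real n * V 1 \<omega> - (V 1 \<omega> - V 0 \<omega>) - (\<Sum>k<n. V (real k / real n) \<omega>)"
      using elim by (subst sum_weighted_increments[of "\<lambda>k. V (real k / real n) \<omega>"]) simp
    finally have ws: "wsum n (\<lambda>x. 1/2 - x) \<omega> = (V 1 \<omega> - V 0 \<omega>) / 2
      - (real n * V 1 \<omega> - (V 1 \<omega> - V 0 \<omega>) - (\<Sum>k<n. V (real k / real n) \<omega>)) / real n" .
    show ?case unfolding ws using elim by (simp add: field_simps)
  qed
  obtain B where B: "\<And>t. \<bar>V t \<omega>\<bar> \<le> B" using V_path_bounded[OF \<omega>] by blast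
  have "(\<lambda>n. (\<Sum>k<n. V (real k / real n) \<omega>) / real n) \<longlonglongrightarrow> S \<omega>"
    unfolding S_def by (rule riemann_sum_tendsto[OF V_path_measurable[OF \<omega>] B])
      (simp add: V_isCont[OF \<omega>])
  then have "(\<lambda>n. (\<Sum>k<n. V (real k / real n) \<omega>) / real n
      + (V 1 \<omega> - V 0 \<omega>) * (1 / real n) - (V 1 \<omega> + V 0 \<omega>) / 2)
      \<longlonglongrightarrow> S \<omega> + (V 1 \<omega> - V 0 \<omega>) * 0 - (V 1 \<omega> + V 0 \<omega>) / 2"
    by (intro tendsto_intros lim_1_over_n)
  from Lim_transform_eventually[OF this eq] show ?thesis by simp
qed

text \<open>
  The area under the Brownian bridge obtained from the path by subtracting the straight line to its end
  point; it generates, together with the end point, the same sigma-algebra as the area does.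
\<close>

definition H :: "'a \<Rightarrow> real" where
  "H \<omega> = S \<omega> - V 1 \<omega> / 2"

lemma H_measurable [measurable]: "H \<in> borel_measurable M"
  unfolding H_def by measurable

text \<open>
  In the expanded square every product of two indicators is again an indicator, of the interval up to the
  smaller time, so that all terms are polynomials on an interval starting at zero.
\<close>

lemma integral_kernel_square:
  assumes u: "u \<in> {0..1}" and v: "v \<in> {0..1}"
  shows "(\<integral>x. (a + b * (1/2 - x) + c * indicator {..<u} x + d * indicator {..<v} x)\<^sup>2 \<partial>unif01)
    = a\<^sup>2 + b\<^sup>2 / 12 + c\<^sup>2 * u + d\<^sup>2 * v + 2 * c * d * min u v + 2 * a * c * u + 2 * a * d * v
      + b * c * u * (1 - u) + b * d * v * (1 - v)"
proof -
  have I: "has_bochner_integral unif01 (\<lambda>x. indicator {0..w} x * (p + q * x + r * x\<^sup>2)) (p * w + q * w\<^sup>2 / 2 + r * w^3 / 3)"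
    if "w \<in> {0..1}" for w p q r :: real
  proof -
    have "has_bochner_integral unif01 (\<lambda>x. indicator {0..w} x * (p + q * x + r * x\<^sup>2))
      ((p * w + q * w\<^sup>2 / 2 + r * w^3 / 3) - (p * 0 + q * 0\<^sup>2 / 2 + r * 0^3 / 3))"
      using that by (intro has_bochner_integral_unif01_FTC)
        (auto intro!: derivative_eq_intros continuous_intros simp: power2_eq_square)
    then show ?thesis by simp
  qed
  have m: "min u v \<in> {0..1}" using u v by auto
  have "has_bochner_integral unif01 (\<lambda>x.
       indicator {0..1} x * ((a + b/2)\<^sup>2 + (- 2 * (a + b/2) * b) * x + b\<^sup>2 * x\<^sup>2)
       + indicator {0..u} x * ((c\<^sup>2 + 2 * c * (a + b/2)) + (- 2 * c * b) * x + 0 * x\<^sup>2)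
       + indicator {0..v} x * ((d\<^sup>2 + 2 * d * (a + b/2)) + (- 2 * d * b) * x + 0 * x\<^sup>2)
       + indicator {0..min u v} x * (2 * c * d + 0 * x + 0 * x\<^sup>2))
     (((a + b/2)\<^sup>2 * 1 + (- 2 * (a + b/2) * b) * 1\<^sup>2 / 2 + b\<^sup>2 * 1^3 / 3)
       + ((c\<^sup>2 + 2 * c * (a + b/2)) * u + (- 2 * c * b) * u\<^sup>2 / 2 + 0 * u^3 / 3)
       + ((d\<^sup>2 + 2 * d * (a + b/2)) * v + (- 2 * d * b) * v\<^sup>2 / 2 + 0 * v^3 / 3)
       + ((2 * c * d) * min u v + 0 * (min u v)\<^sup>2 / 2 + 0 * (min u v)^3 / 3))"
    using u v m by (intro has_bochner_integral_add I) auto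
  then have "(\<integral>x. indicator {0..1} x * ((a + b/2)\<^sup>2 + (- 2 * (a + b/2) * b) * x + b\<^sup>2 * x\<^sup>2)
       + indicator {0..u} x * ((c\<^sup>2 + 2 * c * (a + b/2)) + (- 2 * c * b) * x + 0 * x\<^sup>2)
       + indicator {0..v} x * ((d\<^sup>2 + 2 * d * (a + b/2)) + (- 2 * d * b) * x + 0 * x\<^sup>2)
       + indicator {0..min u v} x * (2 * c * d + 0 * x + 0 * x\<^sup>2) \<partial>unif01)
    = a\<^sup>2 + b\<^sup>2 / 12 + c\<^sup>2 * u + d\<^sup>2 * v + 2 * c * d * min u v + 2 * a * c * u + 2 * a * d * v
      + b * c * u * (1 - u) + b * d * v * (1 - v)"
    by (subst has_bochner_integral_integral_eq, assumption) (simp add: field_simps power2_eq_square)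
  moreover have "AE x in unif01. (a + b * (1/2 - x) + c * indicator {..<u} x + d * indicator {..<v} x)\<^sup>2 =
       indicator {0..1} x * ((a + b/2)\<^sup>2 + (- 2 * (a + b/2) * b) * x + b\<^sup>2 * x\<^sup>2)
       + indicator {0..u} x * ((c\<^sup>2 + 2 * c * (a + b/2)) + (- 2 * c * b) * x + 0 * x\<^sup>2)
       + indicator {0..v} x * ((d\<^sup>2 + 2 * d * (a + b/2)) + (- 2 * d * b) * x + 0 * x\<^sup>2)
       + indicator {0..min u v} x * (2 * c * d + 0 * x + 0 * x\<^sup>2)"
    using AE_unif01_unit AE_unif01_neq[of u] AE_unif01_neq[of v]
  proof eventually_elim
    case (elim x)
    have "x < u \<or> x > u" "x < v \<or> x > v" using elim by auto
    then show ?case using elim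
      by (auto simp: indicator_def power2_eq_square algebra_simps)
  qed
  ultimately show ?thesis by (subst integral_cong_AE) auto
qed

lemma joint_normal:
  assumes u: "u \<in> {0..1}" and v: "v \<in> {0..1}"
  shows "centered_normal (\<lambda>\<omega>. a * V 1 \<omega> + b * H \<omega> + c * V u \<omega> + d * V v \<omega>)
    (a\<^sup>2 + b\<^sup>2 / 12 + c\<^sup>2 * u + d\<^sup>2 * v + 2 * c * d * min u v + 2 * a * c * u + 2 * a * d * v
      + b * c * u * (1 - u) + b * d * v * (1 - v))"
proof -
  let ?f = "\<lambda>x. a + b * (1/2 - x) + c * indicator {..<u} x + d * indicator {..<v} x :: real"
  let ?Y = "\<lambda>\<omega>. a * V 1 \<omega> + b * H \<omega> + c * V u \<omega> + d * V v \<omega>"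
  have "centered_normal ?Y (\<integral>x. (?f x)\<^sup>2 \<partial>unif01)"
  proof (rule wsum_limit_normal)
    show "\<bar>?f x\<bar> \<le> \<bar>a\<bar> + \<bar>b\<bar> + \<bar>c\<bar> + \<bar>d\<bar>" if "x \<in> {0..1}" for x
    proof -
      have "\<bar>b * (1/2 - x)\<bar> \<le> \<bar>b\<bar> * 1" unfolding abs_mult using that by (intro mult_left_mono) auto
      moreover have "\<bar>c * indicator {..<u} x\<bar> \<le> \<bar>c\<bar>" "\<bar>d * indicator {..<v} x\<bar> \<le> \<bar>d\<bar>"
        by (auto simp: indicator_def)
      ultimately show ?thesis by linarith
    qed
    show "AE x in unif01. isCont ?f x"
      using AE_unif01_neq[of u] AE_unif01_neq[of v]
    proof eventually_elim
      case (elim x)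
      then show ?case by (intro continuous_intros isCont_indicator) (auto simp: isCont_indicator)
    qed
    have "AE \<omega> in M. V 0 \<omega> = 0" using starts_at_0 by (simp add: V_eq)
    then show "AE \<omega> in M. (\<lambda>n. wsum n ?f \<omega>) \<longlonglongrightarrow> ?Y \<omega>"
      using AE_space
    proof eventually_elim
      case (elim \<omega>)
      have eq: "wsum n ?f \<omega> = a * wsum n (\<lambda>x. 1) \<omega> + b * wsum n (\<lambda>x. 1/2 - x) \<omega>
          + c * wsum n (indicator {..<u}) \<omega> + d * wsum n (indicator {..<v}) \<omega>" for n
        unfolding wsum_def sum_distrib_left sum.distrib[symmetric]
        by (intro sum.cong refl) (simp add: algebra_simps)
      have "(\<lambda>n. wsum n ?f \<omega>) \<longlonglongrightarrow> a * (V 1 \<omega> - V 0 \<omega>) + b * (S \<omega> - (V 1 \<omega> + V 0 \<omega>) / 2)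
          + c * (V u \<omega> - V 0 \<omega>) + d * (V v \<omega> - V 0 \<omega>)"
        unfolding eq
        by (intro tendsto_intros wsum_const wsum_area wsum_indicator elim u v)
      then show ?case using elim by (simp add: H_def)
    qed
  qed measurable
  then show ?thesis by (simp only: integral_kernel_square[OF u v])
qed

end

section \<open>The path given its end point and its area\<close>

text \<open>
  The covariance of Brownian motion conditioned on its end point and its area: from the covariance
  \<open>min u v - u v\<close> of the bridge, the part explained by the bridge area is subtracted. That part is the product
  of the covariances \<open>u (1 - u) / 2\<close> and \<open>v (1 - v) / 2\<close> with the bridge area, divided by its variance \<open>1 / 12\<close>.
\<close>

definition K :: "real \<Rightarrow> real \<Rightarrow> real" where
  "K u v = min u v - u * v - 3 * (u * (1 - u)) * (v * (1 - v))"

lemma K_measurable [measurable]: "case_prod K \<in> borel_measurable (borel \<Otimes>\<^sub>M borel)"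
  unfolding K_def by measurable

context prob_space
begin

lemma integrable_mult_square:
  fixes X Y :: "'a \<Rightarrow> real"
  assumes [measurable]: "X \<in> borel_measurable M" "Y \<in> borel_measurable M"
    and "integrable M (\<lambda>\<omega>. (X \<omega>)\<^sup>2)" "integrable M (\<lambda>\<omega>. (Y \<omega>)\<^sup>2)"
  shows "integrable M (\<lambda>\<omega>. X \<omega> * Y \<omega>)"
proof (rule Bochner_Integration.integrable_bound)
  show "integrable M (\<lambda>\<omega>. (X \<omega>)\<^sup>2 + (Y \<omega>)\<^sup>2)" using assms by auto
  show "AE \<omega> in M. norm (X \<omega> * Y \<omega>) \<le> norm ((X \<omega>)\<^sup>2 + (Y \<omega>)\<^sup>2)"
  proof (rule AE_I2)
    fix \<omega>
    have "2 * (\<bar>X \<omega>\<bar> * \<bar>Y \<omega>\<bar>) \<le> (X \<omega>)\<^sup>2 + (Y \<omega>)\<^sup>2"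
      using sum_squares_bound[of "\<bar>X \<omega>\<bar>" "\<bar>Y \<omega>\<bar>"] by (simp add: mult.assoc)
    moreover have "0 \<le> \<bar>X \<omega>\<bar> * \<bar>Y \<omega>\<bar>" by simp
    ultimately show "norm (X \<omega> * Y \<omega>) \<le> norm ((X \<omega>)\<^sup>2 + (Y \<omega>)\<^sup>2)"
      unfolding real_norm_def abs_mult by linarith
  qed
qed measurable

lemma has_bochner_integral_moments:
  assumes "centered_normal Y v"
  shows "has_bochner_integral M Y 0" "has_bochner_integral M (\<lambda>\<omega>. Y \<omega> ^ 2) v"
    "has_bochner_integral M (\<lambda>\<omega>. Y \<omega> ^ 3) 0" "has_bochner_integral M (\<lambda>\<omega>. Y \<omega> ^ 4) (3 * v\<^sup>2)"
  using centered_normal_moments[OF assms] centered_normal_moments(1)[OF assms, of 1]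
  by (simp_all add: has_bochner_integral_iff)

text \<open>
  Mixed moments follow from those of \<open>X\<close>, \<open>Y\<close>, \<open>X + Y\<close> and \<open>X - Y\<close> by polarisation, so only the moments of a
  single normal variable are used.
\<close>

lemma bivariate_normal_moments:
  assumes N: "\<And>c d. centered_normal (\<lambda>\<omega>. c * X \<omega> + d * Y \<omega>) (c\<^sup>2 * p + 2 * c * d * k + d\<^sup>2 * q)"
  shows "has_bochner_integral M (\<lambda>\<omega>. X \<omega> * Y \<omega>) k"
    "has_bochner_integral M (\<lambda>\<omega>. X \<omega> * (Y \<omega>)\<^sup>2) 0"
    "has_bochner_integral M (\<lambda>\<omega>. (X \<omega>)\<^sup>2 * (Y \<omega>)\<^sup>2) (p * q + 2 * k\<^sup>2)"
proof -
  note plus = has_bochner_integral_moments[OF N[of 1 1]]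
  note minus = has_bochner_integral_moments[OF N[of 1 "-1"]]
  note x = has_bochner_integral_moments[OF N[of 1 0]]
  note y = has_bochner_integral_moments[OF N[of 0 1]]
  have "has_bochner_integral M (\<lambda>\<omega>. ((1 * X \<omega> + 1 * Y \<omega>)^2 - (1 * X \<omega> + (-1) * Y \<omega>)^2) / 4)
    (((1\<^sup>2 * p + 2 * 1 * 1 * k + 1\<^sup>2 * q) - (1\<^sup>2 * p + 2 * 1 * (-1) * k + (-1)\<^sup>2 * q)) / 4)"
    by (intro has_bochner_integral_divide has_bochner_integral_diff plus minus)
  then show "has_bochner_integral M (\<lambda>\<omega>. X \<omega> * Y \<omega>) k"
    by (simp add: power2_eq_square algebra_simps)
  have "has_bochner_integral M (\<lambda>\<omega>. ((1 * X \<omega> + 1 * Y \<omega>)^3 + (1 * X \<omega> + (-1) * Y \<omega>)^3 - 2 * (1 * X \<omega> + 0 * Y \<omega>)^3) / 6)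
    ((0 + 0 - 2 * 0) / 6)"
    by (intro has_bochner_integral_divide has_bochner_integral_add has_bochner_integral_diff
        has_bochner_integral_mult_right plus minus x)
  then show "has_bochner_integral M (\<lambda>\<omega>. X \<omega> * (Y \<omega>)\<^sup>2) 0"
    by (simp add: power2_eq_square power3_eq_cube algebra_simps)
  have "has_bochner_integral M (\<lambda>\<omega>. ((1 * X \<omega> + 1 * Y \<omega>)^4 + (1 * X \<omega> + (-1) * Y \<omega>)^4
      - 2 * (1 * X \<omega> + 0 * Y \<omega>)^4 - 2 * (0 * X \<omega> + 1 * Y \<omega>)^4) / 12)
    ((3 * (1\<^sup>2 * p + 2 * 1 * 1 * k + 1\<^sup>2 * q)\<^sup>2 + 3 * (1\<^sup>2 * p + 2 * 1 * (-1) * k + (-1)\<^sup>2 * q)\<^sup>2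
      - 2 * (3 * (1\<^sup>2 * p + 2 * 1 * 0 * k + 0\<^sup>2 * q)\<^sup>2) - 2 * (3 * (0\<^sup>2 * p + 2 * 0 * 1 * k + 1\<^sup>2 * q)\<^sup>2)) / 12)"
    by (intro has_bochner_integral_divide has_bochner_integral_add has_bochner_integral_diff
        has_bochner_integral_mult_right plus minus x y)
  moreover have "(3 * (1\<^sup>2 * p + 2 * 1 * 1 * k + 1\<^sup>2 * q)\<^sup>2 + 3 * (1\<^sup>2 * p + 2 * 1 * (-1) * k + (-1)\<^sup>2 * q)\<^sup>2
      - 2 * (3 * (1\<^sup>2 * p + 2 * 1 * 0 * k + 0\<^sup>2 * q)\<^sup>2) - 2 * (3 * (0\<^sup>2 * p + 2 * 0 * 1 * k + 1\<^sup>2 * q)\<^sup>2)) / 12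
      = p * q + 2 * k\<^sup>2"
    by (simp add: power2_eq_square field_simps)
  moreover have "((1 * x + 1 * y)^4 + (1 * x + (-1) * y)^4 - 2 * (1 * x + 0 * y)^4 - 2 * (0 * x + 1 * y)^4) / 12
      = x\<^sup>2 * y\<^sup>2" for x y :: real
    by (simp add: power2_eq_square power4_eq_xxxx field_simps)
  ultimately show "has_bochner_integral M (\<lambda>\<omega>. (X \<omega>)\<^sup>2 * (Y \<omega>)\<^sup>2) (p * q + 2 * k\<^sup>2)"
    by (simp only:)
qed

lemma indep_var_has_bochner_integral_mult:
  fixes f :: "'b \<Rightarrow> real" and g :: "'b \<Rightarrow> real"
  assumes ind: "indep_var N1 X N2 Y" and "f \<in> borel_measurable N1" "g \<in> borel_measurable N2"
    and "integrable M (\<lambda>\<omega>. f (X \<omega>))" "has_bochner_integral M (\<lambda>\<omega>. g (Y \<omega>)) c"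
  shows "has_bochner_integral M (\<lambda>\<omega>. f (X \<omega>) * g (Y \<omega>)) (expectation (\<lambda>\<omega>. f (X \<omega>)) * c)"
proof -
  have "indep_var borel (f \<circ> X) borel (g \<circ> Y)"
    using assms by (intro indep_var_compose[OF ind])
  then show ?thesis
    using indep_var_integrable[of "f \<circ> X" "g \<circ> Y"] indep_var_lebesgue_integral[of "f \<circ> X" "g \<circ> Y"] assms
    by (simp add: has_bochner_integral_iff comp_def)
qed

end

context standard_brownian_motion
begin

text \<open>
  The conditional mean of the path at time \<open>u\<close>. The coefficient of the bridge area is the covariance
  \<open>u (1 - u) / 2\<close> divided by the variance \<open>1 / 12\<close>.
\<close>

definition m :: "real \<Rightarrow> 'a \<Rightarrow> real" where
  "m u \<omega> = u * V 1 \<omega> + 6 * u * (1 - u) * H \<omega>"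

definition R :: "real \<Rightarrow> 'a \<Rightarrow> real" where
  "R u \<omega> = V u \<omega> - m u \<omega>"

lemma m_measurable [measurable]: "m u \<in> borel_measurable M"
  unfolding m_def by measurable

lemma R_measurable [measurable]: "R u \<in> borel_measurable M"
  unfolding R_def by measurable

text \<open>
  There are no terms mixing \<open>a\<close>, \<open>b\<close> with \<open>c\<close>, \<open>d\<close>: this is the orthogonality for which \<open>m\<close> was chosen, and the
  source of the independence below.
\<close>

lemma residual_joint_normal:
  assumes u: "u \<in> {0..1}" and v: "v \<in> {0..1}"
  shows "centered_normal (\<lambda>\<omega>. a * V 1 \<omega> + b * H \<omega> + (c * R u \<omega> + d * R v \<omega>))
    ((a\<^sup>2 + b\<^sup>2 / 12) + (c\<^sup>2 * K u u + 2 * c * d * K u v + d\<^sup>2 * K v v))"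
proof -
  have f: "(\<lambda>\<omega>. a * V 1 \<omega> + b * H \<omega> + (c * R u \<omega> + d * R v \<omega>))
    = (\<lambda>\<omega>. (a - c * u - d * v) * V 1 \<omega> + (b - 6 * c * u * (1 - u) - 6 * d * v * (1 - v)) * H \<omega> + c * V u \<omega> + d * V v \<omega>)"
    by (auto simp: R_def m_def algebra_simps)
  have q: "(a\<^sup>2 + b\<^sup>2 / 12) + (c\<^sup>2 * K u u + 2 * c * d * K u v + d\<^sup>2 * K v v)
     = (let a' = a - c * u - d * v; b' = b - 6 * c * u * (1 - u) - 6 * d * v * (1 - v) in
        a'\<^sup>2 + b'\<^sup>2 / 12 + c\<^sup>2 * u + d\<^sup>2 * v + 2 * c * d * min u v + 2 * a' * c * u + 2 * a' * d * v
      + b' * c * u * (1 - u) + b' * d * v * (1 - v))"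
    unfolding Let_def K_def by (simp add: power2_eq_square field_simps)
  show ?thesis unfolding f q Let_def by (rule joint_normal[OF u v])
qed

lemma residual_indep:
  assumes u: "u \<in> {0..1}" and v: "v \<in> {0..1}"
  shows "indep_var (borel \<Otimes>\<^sub>M borel) (\<lambda>\<omega>. (V 1 \<omega>, H \<omega>)) (borel \<Otimes>\<^sub>M borel) (\<lambda>\<omega>. (R u \<omega>, R v \<omega>))"
proof (rule indep_var_pairs_if_char_factors)
  fix a b c d
  have ch: "expectation (\<lambda>\<omega>. iexp (a * V 1 \<omega> + b * H \<omega> + (c * R u \<omega> + d * R v \<omega>)))
    = of_real (exp (- ((a\<^sup>2 + b\<^sup>2 / 12) / 2)) * exp (- ((c\<^sup>2 * K u u + 2 * c * d * K u v + d\<^sup>2 * K v v) / 2)))"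
    for a b c d
  proof -
    have "expectation (\<lambda>\<omega>. iexp (1 * (a * V 1 \<omega> + b * H \<omega> + (c * R u \<omega> + d * R v \<omega>))))
      = of_real (exp (- (1\<^sup>2 * ((a\<^sup>2 + b\<^sup>2 / 12) + (c\<^sup>2 * K u u + 2 * c * d * K u v + d\<^sup>2 * K v v)) / 2)))"
      using residual_joint_normal[OF u v, of a b c d] unfolding centered_normal_def by blast
    also have "exp (- (1\<^sup>2 * ((a\<^sup>2 + b\<^sup>2 / 12) + (c\<^sup>2 * K u u + 2 * c * d * K u v + d\<^sup>2 * K v v)) / 2))
      = exp (- ((a\<^sup>2 + b\<^sup>2 / 12) / 2)) * exp (- ((c\<^sup>2 * K u u + 2 * c * d * K u v + d\<^sup>2 * K v v) / 2))"
      unfolding exp_add[symmetric] by (rule arg_cong[where f=exp]) (simp add: add_divide_distrib)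
    finally show ?thesis by (simp only: mult_1_left)
  qed
  have 1: "expectation (\<lambda>\<omega>. iexp (a * V 1 \<omega> + b * H \<omega>)) = of_real (exp (- ((a\<^sup>2 + b\<^sup>2 / 12) / 2)))"
    using ch[of a b 0 0] by simp
  have 2: "expectation (\<lambda>\<omega>. iexp (c * R u \<omega> + d * R v \<omega>)) = of_real (exp (- ((c\<^sup>2 * K u u + 2 * c * d * K u v + d\<^sup>2 * K v v) / 2)))"
    using ch[of 0 0 c d] by simp
  show "expectation (\<lambda>\<omega>. iexp (a * V 1 \<omega> + b * H \<omega> + (c * R u \<omega> + d * R v \<omega>)))
    = expectation (\<lambda>\<omega>. iexp (a * V 1 \<omega> + b * H \<omega>)) * expectation (\<lambda>\<omega>. iexp (c * R u \<omega> + d * R v \<omega>))"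
    unfolding ch 1 2 by simp
qed measurable

text \<open>
  The deviation of the squared path from its conditional mean, at a fixed time.
\<close>

definition D :: "real \<Rightarrow> 'a \<Rightarrow> real" where
  "D u \<omega> = (V u \<omega>)\<^sup>2 - (m u \<omega>)\<^sup>2 - K u u"

lemma D_eq: "D u \<omega> = 2 * m u \<omega> * R u \<omega> + ((R u \<omega>)\<^sup>2 - K u u)"
  by (simp add: D_def R_def power2_eq_square algebra_simps)

lemma m_second_moment: "has_bochner_integral M (\<lambda>\<omega>. (m u \<omega>)\<^sup>2) (u\<^sup>2 + (6 * u * (1 - u))\<^sup>2 / 12)"
proof -
  have "centered_normal (\<lambda>\<omega>. u * V 1 \<omega> + (6 * u * (1 - u)) * H \<omega> + (0 * R 0 \<omega> + 0 * R 0 \<omega>))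
    ((u\<^sup>2 + (6 * u * (1 - u))\<^sup>2 / 12) + (0\<^sup>2 * K 0 0 + 2 * 0 * 0 * K 0 0 + 0\<^sup>2 * K 0 0))"
    by (rule residual_joint_normal) auto
  from has_bochner_integral_moments(2)[OF this] show ?thesis by (simp add: m_def[abs_def])
qed

lemmas m_square_integrable = integrable.intros[OF m_second_moment]

lemma residual_moments:
  assumes u: "u \<in> {0..1}" and v: "v \<in> {0..1}"
  shows "has_bochner_integral M (\<lambda>\<omega>. R u \<omega> * R v \<omega>) (K u v)"
    "has_bochner_integral M (\<lambda>\<omega>. R u \<omega> * ((R v \<omega>)\<^sup>2 - K v v)) 0"
    "has_bochner_integral M (\<lambda>\<omega>. ((R u \<omega>)\<^sup>2 - K u u) * ((R v \<omega>)\<^sup>2 - K v v)) (2 * (K u v)\<^sup>2)"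
proof -
  have N: "centered_normal (\<lambda>\<omega>. c * R u \<omega> + d * R v \<omega>) (c\<^sup>2 * K u u + 2 * c * d * K u v + d\<^sup>2 * K v v)"
    if "u \<in> {0..1}" "v \<in> {0..1}" for u v c d
    using residual_joint_normal[OF that, of 0 0 c d] by simp
  note R = bivariate_normal_moments[OF N[OF u v]]
  have 1: "has_bochner_integral M (R u) 0"
    using has_bochner_integral_moments(1)[OF N[OF u u, of 1 0]] by simp
  have 2: "has_bochner_integral M (\<lambda>\<omega>. (R u \<omega>)\<^sup>2) (K u u)" if "u \<in> {0..1}" for u
    using has_bochner_integral_moments(2)[OF N[OF that that, of 1 0]] by simp
  have c: "has_bochner_integral M (\<lambda>\<omega>. c) c" for c :: real
    by (simp add: has_bochner_integral_iff prob_space)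
  show "has_bochner_integral M (\<lambda>\<omega>. R u \<omega> * R v \<omega>) (K u v)" by (rule R(1))
  have "has_bochner_integral M (\<lambda>\<omega>. R u \<omega> * (R v \<omega>)\<^sup>2 - K v v * R u \<omega>) (0 - K v v * 0)"
    by (intro has_bochner_integral_diff has_bochner_integral_mult_right R 1)
  then show "has_bochner_integral M (\<lambda>\<omega>. R u \<omega> * ((R v \<omega>)\<^sup>2 - K v v)) 0"
    by (simp add: algebra_simps)
  have "has_bochner_integral M (\<lambda>\<omega>. (R u \<omega>)\<^sup>2 * (R v \<omega>)\<^sup>2 - K v v * (R u \<omega>)\<^sup>2 - K u u * (R v \<omega>)\<^sup>2 + K u u * K v v)
    ((K u u * K v v + 2 * (K u v)\<^sup>2) - K v v * K u u - K u u * K v v + K u u * K v v)"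
    by (intro has_bochner_integral_diff has_bochner_integral_add has_bochner_integral_mult_right R 2 u v c)
  then show "has_bochner_integral M (\<lambda>\<omega>. ((R u \<omega>)\<^sup>2 - K u u) * ((R v \<omega>)\<^sup>2 - K v v)) (2 * (K u v)\<^sup>2)"
    by (simp add: algebra_simps)
qed

text \<open>
  Expand both factors by \<open>D_eq\<close>. By independence the residual parts can be replaced by their expectations:
  the cross terms have odd degree in the residuals and vanish, the other two give the covariance and
  twice its square. Testing against indicators of sets in the plane expresses the conditioning on the end
  point and the bridge area.
\<close>

lemma conditional_second_moment:
  assumes u: "u \<in> {0..1}" and v: "v \<in> {0..1}" and [measurable]: "B \<in> sets (borel \<Otimes>\<^sub>M borel)"
  shows "has_bochner_integral M (\<lambda>\<omega>. D u \<omega> * D v \<omega> * indicator B (V 1 \<omega>, H \<omega>))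
    (expectation (\<lambda>\<omega>. m u \<omega> * m v \<omega> * indicator B (V 1 \<omega>, H \<omega>)) * (4 * K u v)
      + expectation (\<lambda>\<omega>. indicator B (V 1 \<omega>, H \<omega>)) * (2 * (K u v)\<^sup>2))"
proof -
  let ?I = "\<lambda>\<omega>. indicator B (V 1 \<omega>, H \<omega>) :: real"
  let ?X = "\<lambda>\<omega>. (V 1 \<omega>, H \<omega>)" and ?Y = "\<lambda>\<omega>. (R u \<omega>, R v \<omega>)"
  define \<mu> where "\<mu> w p = w * fst p + 6 * w * (1 - w) * snd p" for w and p :: "real \<times> real"
  have [measurable]: "\<mu> w \<in> borel_measurable (borel \<Otimes>\<^sub>M borel)" for w unfolding \<mu>_def by measurable
  have \<mu>: "m w \<omega> = \<mu> w (V 1 \<omega>, H \<omega>)" for w \<omega> by (simp add: m_def \<mu>_def)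
  have bI: "norm (?I \<omega>) \<le> 1" for \<omega> by (auto simp: indicator_def)
  have iI: "integrable M ?I" by (rule integrable_const_bound[where B=1]) (auto simp: indicator_def)
  have im: "integrable M (\<lambda>\<omega>. m w \<omega> * ?I \<omega>)" for w
  proof -
    have "integrable M (m w)" using integrable_mult_square[of "m w" "\<lambda>_. 1"] m_square_integrable by simp
    then show ?thesis by (rule integrable_mult_bounded[OF _ _ bI]) measurable
  qed
  have imm: "integrable M (\<lambda>\<omega>. m u \<omega> * m v \<omega> * ?I \<omega>)"
    by (rule integrable_mult_bounded[OF _ _ bI]) (auto intro!: integrable_mult_square m_square_integrable)
  note ind = residual_indep[OF u v]
  note F = indep_var_has_bochner_integral_mult[OF ind]
  have t1: "has_bochner_integral M (\<lambda>\<omega>. (m u \<omega> * m v \<omega> * ?I \<omega>) * (R u \<omega> * R v \<omega>))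
      (expectation (\<lambda>\<omega>. m u \<omega> * m v \<omega> * ?I \<omega>) * K u v)"
    using F[of "\<lambda>p. \<mu> u p * \<mu> v p * indicator B p" "\<lambda>p. fst p * snd p"] imm residual_moments(1)[OF u v]
    by (simp add: \<mu>)
  have t2: "has_bochner_integral M (\<lambda>\<omega>. (m u \<omega> * ?I \<omega>) * (R u \<omega> * ((R v \<omega>)\<^sup>2 - K v v)))
      (expectation (\<lambda>\<omega>. m u \<omega> * ?I \<omega>) * 0)"
    using F[of "\<lambda>p. \<mu> u p * indicator B p" "\<lambda>p. fst p * ((snd p)\<^sup>2 - K v v)" 0] im residual_moments(2)[OF u v]
    by (simp add: \<mu>)
  have t3: "has_bochner_integral M (\<lambda>\<omega>. (m v \<omega> * ?I \<omega>) * (R v \<omega> * ((R u \<omega>)\<^sup>2 - K u u)))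
      (expectation (\<lambda>\<omega>. m v \<omega> * ?I \<omega>) * 0)"
    using F[of "\<lambda>p. \<mu> v p * indicator B p" "\<lambda>p. snd p * ((fst p)\<^sup>2 - K u u)" 0] im residual_moments(2)[OF v u]
    by (simp add: \<mu>)
  have t4: "has_bochner_integral M (\<lambda>\<omega>. ?I \<omega> * (((R u \<omega>)\<^sup>2 - K u u) * ((R v \<omega>)\<^sup>2 - K v v)))
      (expectation ?I * (2 * (K u v)\<^sup>2))"
    using F[of "indicator B" "\<lambda>p. ((fst p)\<^sup>2 - K u u) * ((snd p)\<^sup>2 - K v v)"] iI residual_moments(3)[OF u v]
    by simp
  have "has_bochner_integral M (\<lambda>\<omega>. 4 * ((m u \<omega> * m v \<omega> * ?I \<omega>) * (R u \<omega> * R v \<omega>))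
      + 2 * ((m u \<omega> * ?I \<omega>) * (R u \<omega> * ((R v \<omega>)\<^sup>2 - K v v)))
      + 2 * ((m v \<omega> * ?I \<omega>) * (R v \<omega> * ((R u \<omega>)\<^sup>2 - K u u)))
      + ?I \<omega> * (((R u \<omega>)\<^sup>2 - K u u) * ((R v \<omega>)\<^sup>2 - K v v)))
    (4 * (expectation (\<lambda>\<omega>. m u \<omega> * m v \<omega> * ?I \<omega>) * K u v) + 2 * (expectation (\<lambda>\<omega>. m u \<omega> * ?I \<omega>) * 0)
      + 2 * (expectation (\<lambda>\<omega>. m v \<omega> * ?I \<omega>) * 0) + expectation ?I * (2 * (K u v)\<^sup>2))"
    by (intro has_bochner_integral_add has_bochner_integral_mult_right t1 t2 t3 t4)
  moreover have "4 * ((m u \<omega> * m v \<omega> * ?I \<omega>) * (R u \<omega> * R v \<omega>))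
      + 2 * ((m u \<omega> * ?I \<omega>) * (R u \<omega> * ((R v \<omega>)\<^sup>2 - K v v)))
      + 2 * ((m v \<omega> * ?I \<omega>) * (R v \<omega> * ((R u \<omega>)\<^sup>2 - K u u)))
      + ?I \<omega> * (((R u \<omega>)\<^sup>2 - K u u) * ((R v \<omega>)\<^sup>2 - K v v)) = D u \<omega> * D v \<omega> * ?I \<omega>" for \<omega>
    unfolding D_eq by (simp only: ring_distribs mult_ac)
  ultimately show ?thesis by (simp only: mult_zero_right add_0_right mult.left_commute[of 4])
qed

lemma conditional_first_moment:
  assumes u: "u \<in> {0..1}" and [measurable]: "B \<in> sets (borel \<Otimes>\<^sub>M borel)"
  shows "has_bochner_integral M (\<lambda>\<omega>. D u \<omega> * indicator B (V 1 \<omega>, H \<omega>)) 0"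
proof -
  let ?I = "\<lambda>\<omega>. indicator B (V 1 \<omega>, H \<omega>) :: real"
  define \<mu> where "\<mu> p = u * fst p + 6 * u * (1 - u) * snd p" for p :: "real \<times> real"
  have [measurable]: "\<mu> \<in> borel_measurable (borel \<Otimes>\<^sub>M borel)" unfolding \<mu>_def by measurable
  have \<mu>: "m u \<omega> = \<mu> (V 1 \<omega>, H \<omega>)" for \<omega> by (simp add: m_def \<mu>_def)
  have bI: "norm (?I \<omega>) \<le> 1" for \<omega> by (auto simp: indicator_def)
  have iI: "integrable M ?I" by (rule integrable_const_bound[where B=1]) (auto simp: indicator_def)
  have im: "integrable M (\<lambda>\<omega>. m u \<omega> * ?I \<omega>)"
  proof -
    have "integrable M (m u)" using integrable_mult_square[of "m u" "\<lambda>_. 1"] m_square_integrable by simp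
    then show ?thesis by (rule integrable_mult_bounded[OF _ _ bI]) measurable
  qed
  note F = indep_var_has_bochner_integral_mult[OF residual_indep[OF u u]]
  have N: "centered_normal (R u) (K u u)"
    using residual_joint_normal[OF u u, of 0 0 1 0] by simp
  have r1: "has_bochner_integral M (R u) 0" by (rule has_bochner_integral_moments(1)[OF N])
  have r2: "has_bochner_integral M (\<lambda>\<omega>. (R u \<omega>)\<^sup>2 - K u u) 0"
    using has_bochner_integral_diff[OF has_bochner_integral_moments(2)[OF N], of "\<lambda>_. K u u" "K u u"]
    by (simp add: has_bochner_integral_iff prob_space)
  have t1: "has_bochner_integral M (\<lambda>\<omega>. (m u \<omega> * ?I \<omega>) * R u \<omega>) (expectation (\<lambda>\<omega>. m u \<omega> * ?I \<omega>) * 0)"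
    using F[of "\<lambda>p. \<mu> p * indicator B p" "\<lambda>p. fst p" 0] im r1 by (simp add: \<mu>)
  have t2: "has_bochner_integral M (\<lambda>\<omega>. ?I \<omega> * ((R u \<omega>)\<^sup>2 - K u u)) (expectation ?I * 0)"
    using F[of "indicator B" "\<lambda>p. (fst p)\<^sup>2 - K u u" 0] iI r2 by simp
  have "has_bochner_integral M (\<lambda>\<omega>. 2 * ((m u \<omega> * ?I \<omega>) * R u \<omega>) + ?I \<omega> * ((R u \<omega>)\<^sup>2 - K u u))
    (2 * (expectation (\<lambda>\<omega>. m u \<omega> * ?I \<omega>) * 0) + expectation ?I * 0)"
    by (intro has_bochner_integral_add has_bochner_integral_mult_right t1 t2)
  then show ?thesis unfolding D_eq by (simp add: algebra_simps)
qed

end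

section \<open>Integrals of the residual covariance\<close>

text \<open>
  Tailored to the covariance \<open>K u\<close>, which is given by one polynomial below \<open>u\<close> and by another one above.
\<close>

lemma has_bochner_integral_unif01_split:
  fixes h p q :: "real \<Rightarrow> real"
  assumes u: "u \<in> {0..1}" and [measurable]: "h \<in> borel_measurable borel"
    and P: "\<And>x. (P has_real_derivative p x) (at x)" "continuous_on UNIV p"
    and Q: "\<And>x. (Q has_real_derivative q x) (at x)" "continuous_on UNIV q"
    and h: "\<And>v. 0 < v \<Longrightarrow> v < u \<Longrightarrow> h v = p v" "\<And>v. u < v \<Longrightarrow> v < 1 \<Longrightarrow> h v = q v"
  shows "has_bochner_integral unif01 h ((P u - P 0) + (Q 1 - Q u))"
proof -
  have [measurable]: "p \<in> borel_measurable borel" "q \<in> borel_measurable borel"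
    using P Q by (auto intro: borel_measurable_continuous_onI)
  have "has_bochner_integral unif01 (\<lambda>x. indicator {0..u} x * p x + indicator {u..1} x * q x)
     ((P u - P 0) + (Q 1 - Q u))"
    using u by (intro has_bochner_integral_add has_bochner_integral_unif01_FTC P Q) auto
  moreover have "AE v in unif01. indicator {0..u} v * p v + indicator {u..1} v * q v = h v"
    using AE_unif01_unit AE_unif01_neq[of u]
  proof eventually_elim
    case (elim v)
    then have "v < u \<or> u < v" by auto
    then show ?case using elim h[of v] by (auto simp: indicator_def)
  qed
  ultimately show ?thesis
    by (subst (asm) has_bochner_integral_cong_AE) auto
qed

lemma has_bochner_integral_unif01_poly:
  fixes f :: "real \<Rightarrow> real"
  assumes "\<And>x. (F has_real_derivative f x) (at x)" "continuous_on UNIV f" "F 1 - F 0 = c"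
  shows "has_bochner_integral unif01 f c"
proof -
  have "f \<in> borel_measurable borel" using assms(2) by (rule borel_measurable_continuous_onI)
  then have "has_bochner_integral unif01 f ((F 0 - F 0) + (F 1 - F 0))"
    by (intro has_bochner_integral_unif01_split[of 0 f F f F f]) (simp_all add: assms(1,2))
  then show ?thesis using assms(3) by simp
qed

lemma K_below: "v \<le> u \<Longrightarrow> K u v = v - u * v - 3 * (u * (1 - u)) * (v * (1 - v))"
  and K_above: "u \<le> v \<Longrightarrow> K u v = u - u * v - 3 * (u * (1 - u)) * (v * (1 - v))"
  by (simp_all add: K_def)

lemma K_measurable2 [measurable]: "(\<lambda>v. K u v) \<in> borel_measurable borel"
  unfolding K_def by measurable

lemma inner_integral_linear:
  assumes "u \<in> {0..1}"
  shows "has_bochner_integral unif01 (\<lambda>v. v * K u v) (- (u^3) / 6 + u\<^sup>2 / 4 - u / 12)"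
proof -
  have "has_bochner_integral unif01 (\<lambda>v. v * K u v)
   (((\<lambda>v. (1 - u) * v^3 / 3 - 3 * u * (1 - u) * (v^3 / 3 - v^4 / 4)) u
    - (\<lambda>v. (1 - u) * v^3 / 3 - 3 * u * (1 - u) * (v^3 / 3 - v^4 / 4)) 0)
    + ((\<lambda>v. u * v\<^sup>2 / 2 - u * v^3 / 3 - 3 * u * (1 - u) * (v^3 / 3 - v^4 / 4)) 1
    - (\<lambda>v. u * v\<^sup>2 / 2 - u * v^3 / 3 - 3 * u * (1 - u) * (v^3 / 3 - v^4 / 4)) u))"
    by (rule has_bochner_integral_unif01_split[OF assms,
       where p = "\<lambda>v. (1 - u) * v^2 - 3 * u * (1 - u) * (v^2 - v^3)"
        and q = "\<lambda>v. u * v - u * v^2 - 3 * u * (1 - u) * (v^2 - v^3)"])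
      (auto intro!: derivative_eq_intros continuous_intros
       simp: K_below K_above less_imp_le power2_eq_square power3_eq_cube field_simps)
  then show ?thesis
    by (rule back_subst[where P="has_bochner_integral unif01 _"])
       (simp add: field_simps power2_eq_square power3_eq_cube power4_eq_xxxx)
qed

lemma inner_integral_quadratic:
  assumes "u \<in> {0..1}"
  shows "has_bochner_integral unif01 (\<lambda>v. (6 * v * (1 - v)) * K u v) (- u / 10 + 3 * u\<^sup>2 / 5 - u^3 + u^4 / 2)"
proof -
  have "has_bochner_integral unif01 (\<lambda>v. (6 * v * (1 - v)) * K u v)
   (((\<lambda>v. 6 * (1 - u) * (v^3 / 3 - v^4 / 4) - 18 * u * (1 - u) * (v^3 / 3 - v^4 / 2 + v^5 / 5)) u
    - (\<lambda>v. 6 * (1 - u) * (v^3 / 3 - v^4 / 4) - 18 * u * (1 - u) * (v^3 / 3 - v^4 / 2 + v^5 / 5)) 0)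
    + ((\<lambda>v. 6 * u * (v^2 / 2 - 2 * v^3 / 3 + v^4 / 4) - 18 * u * (1 - u) * (v^3 / 3 - v^4 / 2 + v^5 / 5)) 1
    - (\<lambda>v. 6 * u * (v^2 / 2 - 2 * v^3 / 3 + v^4 / 4) - 18 * u * (1 - u) * (v^3 / 3 - v^4 / 2 + v^5 / 5)) u))"
    by (rule has_bochner_integral_unif01_split[OF assms,
       where p = "\<lambda>v. 6 * (1 - u) * (v^2 - v^3) - 18 * u * (1 - u) * (v^2 - 2 * v^3 + v^4)"
        and q = "\<lambda>v. 6 * u * (v - 2 * v^2 + v^3) - 18 * u * (1 - u) * (v^2 - 2 * v^3 + v^4)"])
      (auto intro!: derivative_eq_intros continuous_intros
       simp: K_below K_above less_imp_le power2_eq_square power3_eq_cube power4_eq_xxxx field_simps)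
  then show ?thesis
    by (rule back_subst[where P="has_bochner_integral unif01 _"])
       (simp add: field_simps power2_eq_square power3_eq_cube power4_eq_xxxx power_numeral_reduce)
qed

text \<open>
  On each side of \<open>u\<close> the covariance factors, as it is zero at the end of the interval on that side. The other
  factor is affine in \<open>v\<close>, with coefficients for which \<open>s\<close> and \<open>w\<close> are abbreviations.
\<close>

lemma inner_integral_square:
  assumes "u \<in> {0..1}"
  shows "has_bochner_integral unif01 (\<lambda>v. (K u v)\<^sup>2)
    (2 / 15 * u\<^sup>2 - 23 / 30 * u^3 + 49 / 30 * u^4 - 3 / 2 * u^5 + 1 / 2 * u^6)"
proof -
  define s w where "s = 1 - 3 * u" and "w = 3 * (1 - u)"
  have below: "(K u v)\<^sup>2 = (1 - u)\<^sup>2 * (s\<^sup>2 * v^2 + 6 * s * u * v^3 + 9 * u\<^sup>2 * v^4)" if "v \<le> u" for v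
  proof -
    have e: "K u v = (1 - u) * (v * (s + 3 * u * v))" unfolding K_below[OF that] s_def by (simp add: algebra_simps)
    show ?thesis unfolding e by (simp add: power2_eq_square power3_eq_cube power4_eq_xxxx algebra_simps)
  qed
  have above: "(K u v)\<^sup>2 = u\<^sup>2 * (1 - 2 * (1 + w) * v + ((1 + w)\<^sup>2 + 2 * w) * v^2 - 2 * w * (1 + w) * v^3 + w\<^sup>2 * v^4)"
    if "u \<le> v" for v
  proof -
    have e: "K u v = u * ((1 - v) * (1 - w * v))" unfolding K_above[OF that] w_def by (simp add: algebra_simps)
    show ?thesis unfolding e by (simp add: power2_eq_square power3_eq_cube power4_eq_xxxx algebra_simps)
  qed
  have "has_bochner_integral unif01 (\<lambda>v. (K u v)\<^sup>2)
   (((\<lambda>v. (1 - u)\<^sup>2 * (s\<^sup>2 * v^3 / 3 + 3 * s * u * v^4 / 2 + 9 * u\<^sup>2 * v^5 / 5)) u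
    - (\<lambda>v. (1 - u)\<^sup>2 * (s\<^sup>2 * v^3 / 3 + 3 * s * u * v^4 / 2 + 9 * u\<^sup>2 * v^5 / 5)) 0)
    + ((\<lambda>v. u\<^sup>2 * (v - (1 + w) * v^2 + ((1 + w)\<^sup>2 + 2 * w) * v^3 / 3 - w * (1 + w) * v^4 / 2 + w\<^sup>2 * v^5 / 5)) 1
    - (\<lambda>v. u\<^sup>2 * (v - (1 + w) * v^2 + ((1 + w)\<^sup>2 + 2 * w) * v^3 / 3 - w * (1 + w) * v^4 / 2 + w\<^sup>2 * v^5 / 5)) u))"
    by (rule has_bochner_integral_unif01_split[OF assms,
       where p = "\<lambda>v. (1 - u)\<^sup>2 * (s\<^sup>2 * v^2 + 6 * s * u * v^3 + 9 * u\<^sup>2 * v^4)"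
        and q = "\<lambda>v. u\<^sup>2 * (1 - 2 * (1 + w) * v + ((1 + w)\<^sup>2 + 2 * w) * v^2 - 2 * w * (1 + w) * v^3 + w\<^sup>2 * v^4)"])
      (auto intro!: derivative_eq_intros continuous_intros simp: below above less_imp_le)
  then show ?thesis
    by (rule back_subst[where P="has_bochner_integral unif01 _"])
       (simp add: s_def w_def field_simps power2_eq_square power3_eq_cube power4_eq_xxxx power_numeral_reduce)
qed

text \<open>
  The four coefficients of the final quadratic polynomial, up to the factors \<open>4\<close> and \<open>2\<close> of
  \<open>conditional_second_moment\<close>. The one belonging to the product of end point and bridge area is zero: under
  time reversal \<open>K(u,v)\<close> and \<open>u (1 - u)\<close> are invariant and \<open>u - 1/2\<close> is odd, and the remaining constant \<open>1/2\<close> does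
  not contribute because the residual encloses no area, so that \<open>K\<close> integrates to zero in each variable.
\<close>

lemma double_integrals:
  "(\<integral>u. (\<integral>v. (u * v) * K u v \<partial>unif01) \<partial>unif01) = 1 / 720"
  "(\<integral>u. (\<integral>v. (u * (6 * v * (1 - v)) + (6 * u * (1 - u)) * v) * K u v \<partial>unif01) \<partial>unif01) = 0"
  "(\<integral>u. (\<integral>v. ((6 * u * (1 - u)) * (6 * v * (1 - v))) * K u v \<partial>unif01) \<partial>unif01) = 1 / 700"
  "(\<integral>u. (\<integral>v. (K u v)\<^sup>2 \<partial>unif01) \<partial>unif01) = 11 / 12600"
proof -
  have outer: "(\<integral>u. (\<integral>v. h u v \<partial>unif01) \<partial>unif01) = c"
    if inner: "\<And>u. u \<in> {0..1} \<Longrightarrow> has_bochner_integral unif01 (h u) (f u)"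
      and [measurable]: "case_prod h \<in> borel_measurable (borel \<Otimes>\<^sub>M borel)"
      and f: "\<And>x. (F has_real_derivative f x) (at x)" "continuous_on UNIV f" "F 1 - F 0 = c"
    for h :: "real \<Rightarrow> real \<Rightarrow> real" and f F c
  proof -
    have [measurable]: "f \<in> borel_measurable borel" using f by (auto intro: borel_measurable_continuous_onI)
    have "AE u in unif01. (\<integral>v. h u v \<partial>unif01) = f u"
      using AE_unif01_unit
    proof eventually_elim
      case (elim u)
      then show ?case by (intro has_bochner_integral_integral_eq inner) auto
    qed
    then have "(\<integral>u. (\<integral>v. h u v \<partial>unif01) \<partial>unif01) = (\<integral>u. f u \<partial>unif01)"
      by (rule integral_cong_AE[rotated 2]) measurable
    also have "\<dots> = c" by (rule has_bochner_integral_integral_eq[OF has_bochner_integral_unif01_poly[OF f]])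
    finally show ?thesis .
  qed
  note lin = inner_integral_linear and quad = inner_integral_quadratic
  show "(\<integral>u. (\<integral>v. (u * v) * K u v \<partial>unif01) \<partial>unif01) = 1 / 720"
  proof (rule outer)
    show "has_bochner_integral unif01 (\<lambda>v. (u * v) * K u v) (u * (- (u^3) / 6 + u\<^sup>2 / 4 - u / 12))"
      if "u \<in> {0..1}" for u
      unfolding mult.assoc by (intro has_bochner_integral_mult_right lin that)
    show "((\<lambda>u. - (u^5) / 30 + u^4 / 16 - u^3 / 36) has_real_derivative u * (- (u^3) / 6 + u\<^sup>2 / 4 - u / 12)) (at u)" for u :: real
      by (auto intro!: derivative_eq_intros simp: power2_eq_square power3_eq_cube power4_eq_xxxx field_simps)
  qed (auto intro!: continuous_intros)
  show "(\<integral>u. (\<integral>v. (u * (6 * v * (1 - v)) + (6 * u * (1 - u)) * v) * K u v \<partial>unif01) \<partial>unif01) = 0"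
  proof (rule outer)
    show "has_bochner_integral unif01 (\<lambda>v. (u * (6 * v * (1 - v)) + (6 * u * (1 - u)) * v) * K u v)
      (u * (- u / 10 + 3 * u\<^sup>2 / 5 - u^3 + u^4 / 2) + (6 * u * (1 - u)) * (- (u^3) / 6 + u\<^sup>2 / 4 - u / 12))"
      if "u \<in> {0..1}" for u
    proof -
      have "has_bochner_integral unif01 (\<lambda>v. u * ((6 * v * (1 - v)) * K u v) + (6 * u * (1 - u)) * (v * K u v))
      (u * (- u / 10 + 3 * u\<^sup>2 / 5 - u^3 + u^4 / 2) + (6 * u * (1 - u)) * (- (u^3) / 6 + u\<^sup>2 / 4 - u / 12))"
        by (intro has_bochner_integral_add has_bochner_integral_mult_right lin quad that)
      then show ?thesis by (simp only: distrib_right mult.assoc)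
    qed
    show "((\<lambda>u. (- (u^3) / 30 + 3 * u^4 / 20 - u^5 / 5 + u^6 / 12) + (- (u^3) / 6 + u^4 / 2 - u^5 / 2 + u^6 / 6))
      has_real_derivative
      u * (- u / 10 + 3 * u\<^sup>2 / 5 - u^3 + u^4 / 2) + (6 * u * (1 - u)) * (- (u^3) / 6 + u\<^sup>2 / 4 - u / 12)) (at u)" for u :: real
      by (auto intro!: derivative_eq_intros
        simp: power2_eq_square power3_eq_cube power4_eq_xxxx power_numeral_reduce field_simps)
  qed (auto intro!: continuous_intros)
  show "(\<integral>u. (\<integral>v. ((6 * u * (1 - u)) * (6 * v * (1 - v))) * K u v \<partial>unif01) \<partial>unif01) = 1 / 700"
  proof (rule outer)
    show "has_bochner_integral unif01 (\<lambda>v. ((6 * u * (1 - u)) * (6 * v * (1 - v))) * K u v)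
      ((6 * u * (1 - u)) * (- u / 10 + 3 * u\<^sup>2 / 5 - u^3 + u^4 / 2))"
      if "u \<in> {0..1}" for u
      using has_bochner_integral_mult_right[OF quad[OF that], of "6 * u * (1 - u)"] by (simp only: mult.assoc)
    show "((\<lambda>u. - (u^3) / 5 + 21 * u^4 / 20 - 48 * u^5 / 25 + 3 * u^6 / 2 - 3 * u^7 / 7)
      has_real_derivative (6 * u * (1 - u)) * (- u / 10 + 3 * u\<^sup>2 / 5 - u^3 + u^4 / 2)) (at u)" for u :: real
      by (auto intro!: derivative_eq_intros
        simp: power2_eq_square power3_eq_cube power4_eq_xxxx power_numeral_reduce field_simps)
  qed (auto intro!: continuous_intros)
  show "(\<integral>u. (\<integral>v. (K u v)\<^sup>2 \<partial>unif01) \<partial>unif01) = 11 / 12600"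
  proof (rule outer)
    show "((\<lambda>u. 2 / 45 * u^3 - 23 / 120 * u^4 + 49 / 150 * u^5 - 1 / 4 * u^6 + 1 / 14 * u^7)
      has_real_derivative 2 / 15 * u\<^sup>2 - 23 / 30 * u^3 + 49 / 30 * u^4 - 3 / 2 * u^5 + 1 / 2 * u^6) (at u)" for u :: real
      by (auto intro!: derivative_eq_intros)
  qed (intro inner_integral_square, assumption | auto intro!: continuous_intros)+
qed

lemma integral_mean_square:
  "has_bochner_integral unif01 (\<lambda>u. (u * a + 6 * u * (1 - u) * h)\<^sup>2 + K u u) (a\<^sup>2 / 3 + a * h + 6 / 5 * h\<^sup>2 + 1 / 15)"
proof (rule has_bochner_integral_unif01_poly)
  show "((\<lambda>u. a\<^sup>2 * u^3 / 3 + 12 * a * h * (u^3 / 3 - u^4 / 4) + 36 * h\<^sup>2 * (u^3 / 3 - u^4 / 2 + u^5 / 5)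
    + (u^2 / 2 - u^3 / 3 - 3 * (u^3 / 3 - u^4 / 2 + u^5 / 5)))
    has_real_derivative (u * a + 6 * u * (1 - u) * h)\<^sup>2 + K u u) (at u)" for u
    by (auto intro!: derivative_eq_intros simp: K_def power2_eq_square power3_eq_cube power4_eq_xxxx field_simps)
qed (auto intro!: continuous_intros simp: K_def field_simps)

section \<open>The conditional variance\<close>

text \<open>
  For Fubini's theorem it suffices to bound the integrals over the fibres, here by second moments that
  are continuous functions of the times.
\<close>

lemma (in pair_sigma_finite) integrable_pair_if_bounded_fibres:
  fixes f :: "'a \<times> 'b \<Rightarrow> 'c::{banach, second_countable_topology}"
  assumes [measurable]: "f \<in> borel_measurable (M1 \<Otimes>\<^sub>M M2)" and g: "integrable M1 g"
    and f: "AE x in M1. integrable M2 (\<lambda>y. f (x, y)) \<and> (\<integral>y. norm (f (x, y)) \<partial>M2) \<le> g x"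
  shows "integrable (M1 \<Otimes>\<^sub>M M2) f"
proof (rule Fubini_integrable)
  show "integrable M1 (\<lambda>x. \<integral>y. norm (f (x, y)) \<partial>M2)"
    using g
  proof (rule Bochner_Integration.integrable_bound)
    show "AE x in M1. norm (\<integral>y. norm (f (x, y)) \<partial>M2) \<le> norm (g x)"
      using f by eventually_elim (auto intro: order_trans[OF _ abs_ge_self])
  qed measurable
  show "AE x in M1. integrable M2 (\<lambda>y. f (x, y))" using f by eventually_elim simp
qed measurable

interpretation square: pair_prob_space unif01 unif01 ..

lemma AE_unit_square: "AE p in unif01 \<Otimes>\<^sub>M unif01. fst p \<in> {0..1} \<and> snd p \<in> {0..1}"
proof (rule square.AE_pair_measure)
  show "AE x in unif01. AE y in unif01. fst (x, y) \<in> {0..1} \<and> snd (x, y) \<in> {0..1}"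
    using AE_unif01_unit
  proof eventually_elim
    case (elim x)
    show ?case using AE_unif01_unit by eventually_elim (use elim in auto)
  qed
qed measurable

lemma integrable_unit_square:
  fixes h :: "real \<times> real \<Rightarrow> real"
  assumes h: "continuous_on UNIV h"
  shows "integrable (unif01 \<Otimes>\<^sub>M unif01) h"
proof -
  have "h \<in> borel_measurable (borel \<Otimes>\<^sub>M borel)"
    unfolding borel_prod using h by (rule borel_measurable_continuous_onI)
  then have [measurable]: "h \<in> borel_measurable (unif01 \<Otimes>\<^sub>M unif01)" by simp
  have "compact (h ` ({0..1} \<times> {0..1}))"
    using h by (intro compact_continuous_image compact_Times) (auto intro: continuous_on_subset)
  then obtain B where B: "\<And>p. p \<in> {0..1} \<times> {0..1} \<Longrightarrow> \<bar>h p\<bar> \<le> B"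
    using compact_imp_bounded bounded_iff by (metis imageI real_norm_def)
  show ?thesis
  proof (rule square.P.integrable_const_bound)
    show "AE p in unif01 \<Otimes>\<^sub>M unif01. norm (h p) \<le> B"
      using AE_unit_square by eventually_elim (use B in \<open>auto simp: mem_Times_iff\<close>)
  qed measurable
qed

lemma continuous_on_K: "continuous_on UNIV (\<lambda>p. K (fst p) (snd p))"
  and continuous_on_K_diag: "continuous_on UNIV (\<lambda>p. K (fst p) (fst p))" "continuous_on UNIV (\<lambda>p. K (snd p) (snd p))"
  unfolding K_def by (intro continuous_intros)+

lemma square_integrals:
  "has_bochner_integral (unif01 \<Otimes>\<^sub>M unif01) (\<lambda>p. (fst p * snd p) * K (fst p) (snd p)) (1 / 720)"
  "has_bochner_integral (unif01 \<Otimes>\<^sub>M unif01)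
    (\<lambda>p. (fst p * (6 * snd p * (1 - snd p)) + (6 * fst p * (1 - fst p)) * snd p) * K (fst p) (snd p)) 0"
  "has_bochner_integral (unif01 \<Otimes>\<^sub>M unif01)
    (\<lambda>p. ((6 * fst p * (1 - fst p)) * (6 * snd p * (1 - snd p))) * K (fst p) (snd p)) (1 / 700)"
  "has_bochner_integral (unif01 \<Otimes>\<^sub>M unif01) (\<lambda>p. (K (fst p) (snd p))\<^sup>2) (11 / 12600)"
proof -
  have *: "has_bochner_integral (unif01 \<Otimes>\<^sub>M unif01) h c"
    if "continuous_on UNIV h" "(\<integral>u. (\<integral>v. h (u, v) \<partial>unif01) \<partial>unif01) = c" for h :: "real \<times> real \<Rightarrow> real" and c
    using integrable_unit_square[OF that(1)] square.integral_fst'[of h] that(2)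
    by (simp add: has_bochner_integral_iff)
  show "has_bochner_integral (unif01 \<Otimes>\<^sub>M unif01) (\<lambda>p. (fst p * snd p) * K (fst p) (snd p)) (1 / 720)"
    by (rule *, intro continuous_intros continuous_on_K) (simp only: fst_conv snd_conv double_integrals)
  show "has_bochner_integral (unif01 \<Otimes>\<^sub>M unif01)
    (\<lambda>p. (fst p * (6 * snd p * (1 - snd p)) + (6 * fst p * (1 - fst p)) * snd p) * K (fst p) (snd p)) 0"
    by (rule *, intro continuous_intros continuous_on_K) (simp only: fst_conv snd_conv double_integrals)
  show "has_bochner_integral (unif01 \<Otimes>\<^sub>M unif01)
    (\<lambda>p. ((6 * fst p * (1 - fst p)) * (6 * snd p * (1 - snd p))) * K (fst p) (snd p)) (1 / 700)"
    by (rule *, intro continuous_intros continuous_on_K) (simp only: fst_conv snd_conv double_integrals)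
  show "has_bochner_integral (unif01 \<Otimes>\<^sub>M unif01) (\<lambda>p. (K (fst p) (snd p))\<^sup>2) (11 / 12600)"
    by (rule *, intro continuous_intros continuous_on_K) (simp only: fst_conv snd_conv double_integrals)
qed

context standard_brownian_motion
begin

lemma UNIV_in_sets_borel_pair: "UNIV \<in> sets (borel \<Otimes>\<^sub>M borel :: (real \<times> real) measure)"
  using sets.top[of "borel \<Otimes>\<^sub>M borel :: (real \<times> real) measure"] by (simp add: space_pair_measure)

lemma square_integrable_V1_H:
  shows "integrable M (\<lambda>\<omega>. (V 1 \<omega>)\<^sup>2)" "integrable M (\<lambda>\<omega>. (H \<omega>)\<^sup>2)"
proof -
  have *: "integrable M (\<lambda>\<omega>. (a * V 1 \<omega> + b * H \<omega>)\<^sup>2)" for a b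
    using centered_normal_moments(1)[OF residual_joint_normal[of 0 0 a b 0 0], of 2] by simp
  show "integrable M (\<lambda>\<omega>. (V 1 \<omega>)\<^sup>2)" "integrable M (\<lambda>\<omega>. (H \<omega>)\<^sup>2)"
    using *[of 1 0] *[of 0 1] by simp_all
qed

text \<open>
  The conditional mean of the integral of the squared path: the integral over \<open>u\<close> of \<open>m\<^sub>u\<^sup>2 + K(u,u)\<close>.
\<close>

definition G :: "'a \<Rightarrow> real" where
  "G \<omega> = (V 1 \<omega>)\<^sup>2 / 3 + V 1 \<omega> * H \<omega> + 6 / 5 * (H \<omega>)\<^sup>2 + 1 / 15"

lemma G_measurable [measurable]: "G \<in> borel_measurable M"
  unfolding G_def by measurable

lemma G_integrable: "integrable M G"
  unfolding G_def by (intro Bochner_Integration.integrable_add integrable_mult_right integrable_divide_zero integrable_mult_square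
      square_integrable_V1_H) auto

lemma integral_D:
  assumes \<omega>: "\<omega> \<in> space M"
  shows "has_bochner_integral unif01 (\<lambda>u. D u \<omega>) (Q \<omega> - G \<omega>)"
proof -
  note V_path_measurable[OF \<omega>, measurable]
  obtain B where B: "\<And>t. \<bar>V t \<omega>\<bar> \<le> B" using V_path_bounded[OF \<omega>] by blast
  have "integrable unif01 (\<lambda>u. (V u \<omega>)\<^sup>2)"
  proof (rule unif01.integrable_const_bound[where B="B\<^sup>2"])
    have "(V u \<omega>)\<^sup>2 \<le> B\<^sup>2" for u using B[of u] by (metis abs_ge_zero power2_abs power_mono)
    then show "AE u in unif01. norm ((V u \<omega>)\<^sup>2) \<le> B\<^sup>2" by simp
  qed measurable
  then have "has_bochner_integral unif01 (\<lambda>u. (V u \<omega>)\<^sup>2) (Q \<omega>)"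
    by (simp add: has_bochner_integral_iff Q_def)
  from has_bochner_integral_diff[OF this integral_mean_square[of "V 1 \<omega>" "H \<omega>"]]
  show ?thesis by (simp add: D_def m_def G_def diff_diff_eq)
qed

lemma D_measurable [measurable]: "case_prod D \<in> borel_measurable (borel \<Otimes>\<^sub>M M)"
  unfolding D_def m_def by measurable

lemma D_second_moment:
  assumes u: "u \<in> {0..1}"
  shows "has_bochner_integral M (\<lambda>\<omega>. (D u \<omega>)\<^sup>2)
    ((u\<^sup>2 + (6 * u * (1 - u))\<^sup>2 / 12) * (4 * K u u) + 2 * (K u u)\<^sup>2)"
  using conditional_second_moment[OF u u UNIV_in_sets_borel_pair] m_second_moment[of u]
  by (simp add: has_bochner_integral_iff power2_eq_square prob_space)

lemma integrable_DD:
  assumes [measurable]: "B \<in> sets (borel \<Otimes>\<^sub>M borel)"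
  shows "integrable ((unif01 \<Otimes>\<^sub>M unif01) \<Otimes>\<^sub>M M)
    (\<lambda>(p, \<omega>). D (fst p) \<omega> * D (snd p) \<omega> * indicator B (V 1 \<omega>, H \<omega>))"
proof -
  interpret P: pair_prob_space "unif01 \<Otimes>\<^sub>M unif01" M ..
  let ?s = "\<lambda>u. (u\<^sup>2 + (6 * u * (1 - u))\<^sup>2 / 12) * (4 * K u u) + 2 * (K u u)\<^sup>2"
  let ?f = "\<lambda>(p, \<omega>). D (fst p) \<omega> * D (snd p) \<omega> * indicator B (V 1 \<omega>, H \<omega>)"
  show ?thesis
  proof (rule P.integrable_pair_if_bounded_fibres)
    show "?f \<in> borel_measurable ((unif01 \<Otimes>\<^sub>M unif01) \<Otimes>\<^sub>M M)" by measurable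
    show "integrable (unif01 \<Otimes>\<^sub>M unif01) (\<lambda>p. ?s (fst p) + ?s (snd p))"
      by (intro integrable_unit_square continuous_intros continuous_on_K_diag) auto
    show "AE p in unif01 \<Otimes>\<^sub>M unif01. integrable M (\<lambda>\<omega>. ?f (p, \<omega>))
        \<and> (\<integral>\<omega>. norm (?f (p, \<omega>)) \<partial>M) \<le> ?s (fst p) + ?s (snd p)"
      using AE_unit_square
    proof eventually_elim
      case (elim p)
      have fp: "fst p \<in> {0..1}" and sp: "snd p \<in> {0..1}" using elim by auto
      have s: "has_bochner_integral M (\<lambda>\<omega>. (D (fst p) \<omega>)\<^sup>2 + (D (snd p) \<omega>)\<^sup>2) (?s (fst p) + ?s (snd p))"
        by (intro has_bochner_integral_add D_second_moment fp sp)
      have i: "integrable M (\<lambda>\<omega>. ?f (p, \<omega>))"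
        using conditional_second_moment[OF fp sp assms] by (auto simp: has_bochner_integral_iff)
      have "(\<integral>\<omega>. norm (?f (p, \<omega>)) \<partial>M) \<le> (\<integral>\<omega>. (D (fst p) \<omega>)\<^sup>2 + (D (snd p) \<omega>)\<^sup>2 \<partial>M)"
      proof (rule integral_mono)
        show "integrable M (\<lambda>\<omega>. norm (?f (p, \<omega>)))" using i by (rule integrable_norm)
        show "integrable M (\<lambda>\<omega>. (D (fst p) \<omega>)\<^sup>2 + (D (snd p) \<omega>)\<^sup>2)" using s by (simp add: has_bochner_integral_iff)
        fix \<omega>
        have "2 * (\<bar>D (fst p) \<omega>\<bar> * \<bar>D (snd p) \<omega>\<bar>) \<le> (D (fst p) \<omega>)\<^sup>2 + (D (snd p) \<omega>)\<^sup>2"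
          using sum_squares_bound[of "\<bar>D (fst p) \<omega>\<bar>" "\<bar>D (snd p) \<omega>\<bar>"] by (simp add: mult.assoc)
        moreover have "0 \<le> \<bar>D (fst p) \<omega>\<bar> * \<bar>D (snd p) \<omega>\<bar>" by simp
        ultimately have "\<bar>D (fst p) \<omega>\<bar> * \<bar>D (snd p) \<omega>\<bar> \<le> (D (fst p) \<omega>)\<^sup>2 + (D (snd p) \<omega>)\<^sup>2"
          by linarith
        then show "norm (?f (p, \<omega>)) \<le> (D (fst p) \<omega>)\<^sup>2 + (D (snd p) \<omega>)\<^sup>2"
          by (auto simp: indicator_def abs_mult)
      qed
      also have "\<dots> = ?s (fst p) + ?s (snd p)" by (rule has_bochner_integral_integral_eq[OF s])
      finally show ?case using i by blast
    qed
  qed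
qed

text \<open>
  The square of an integral is a double integral. After exchanging it with the expectation, the integrand
  is \<open>conditional_second_moment\<close>, which depends on \<open>B\<close> only through the four expectations \<open>a0\<close>,
  \<open>a1\<close>, \<open>a2\<close>, \<open>a3\<close>; what remains are the integrals over the unit square.
\<close>

lemma residual_square_integral:
  assumes B[measurable]: "B \<in> sets (borel \<Otimes>\<^sub>M borel)"
  shows "has_bochner_integral M (\<lambda>\<omega>. (Q \<omega> - G \<omega>)\<^sup>2 * indicator B (V 1 \<omega>, H \<omega>))
    (expectation (\<lambda>\<omega>. (11 / 6300 + 1 / 180 * (V 1 \<omega>)\<^sup>2 + 1 / 175 * (H \<omega>)\<^sup>2) * indicator B (V 1 \<omega>, H \<omega>)))"
proof -
  interpret P: pair_prob_space "unif01 \<Otimes>\<^sub>M unif01" M ..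
  let ?I = "\<lambda>\<omega>. indicator B (V 1 \<omega>, H \<omega>) :: real"
  let ?f = "\<lambda>p \<omega>. D (fst p) \<omega> * D (snd p) \<omega> * ?I \<omega>"
  note DD = integrable_DD[OF B]
  have "AE \<omega> in M. (\<integral>p. ?f p \<omega> \<partial>(unif01 \<Otimes>\<^sub>M unif01)) = (Q \<omega> - G \<omega>)\<^sup>2 * ?I \<omega>"
    using P.AE_integrable_snd[OF DD] AE_space
  proof eventually_elim
    case (elim \<omega>)
    have "(\<integral>p. ?f p \<omega> \<partial>(unif01 \<Otimes>\<^sub>M unif01)) = (\<integral>u. (\<integral>v. D u \<omega> * D v \<omega> * ?I \<omega> \<partial>unif01) \<partial>unif01)"
      using square.integral_fst'[OF elim(1), symmetric] by (simp only: fst_conv snd_conv)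
    also have "\<dots> = (\<integral>u. D u \<omega> \<partial>unif01) * (\<integral>v. D v \<omega> \<partial>unif01) * ?I \<omega>"
      by simp
    also have "\<dots> = (Q \<omega> - G \<omega>)\<^sup>2 * ?I \<omega>"
      using has_bochner_integral_integral_eq[OF integral_D[OF elim(2)]] by (simp add: power2_eq_square)
    finally show ?case .
  qed
  moreover have "integrable M (\<lambda>\<omega>. \<integral>p. ?f p \<omega> \<partial>(unif01 \<Otimes>\<^sub>M unif01))"
    by (rule P.integrable_snd[OF DD])
  moreover have [measurable]: "(\<lambda>\<omega>. \<integral>p. ?f p \<omega> \<partial>(unif01 \<Otimes>\<^sub>M unif01)) \<in> borel_measurable M" by measurable
  ultimately have L: "has_bochner_integral M (\<lambda>\<omega>. (Q \<omega> - G \<omega>)\<^sup>2 * ?I \<omega>)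
      (\<integral>\<omega>. (\<integral>p. ?f p \<omega> \<partial>(unif01 \<Otimes>\<^sub>M unif01)) \<partial>M)"
    by (subst has_bochner_integral_cong_AE[where g="\<lambda>\<omega>. \<integral>p. ?f p \<omega> \<partial>(unif01 \<Otimes>\<^sub>M unif01)"])
      (auto simp: has_bochner_integral_iff)
  define a1 where "a1 = expectation (\<lambda>\<omega>. (V 1 \<omega>)\<^sup>2 * ?I \<omega>)"
  define a2 where "a2 = expectation (\<lambda>\<omega>. V 1 \<omega> * H \<omega> * ?I \<omega>)"
  define a3 where "a3 = expectation (\<lambda>\<omega>. (H \<omega>)\<^sup>2 * ?I \<omega>)"
  define a0 where "a0 = expectation ?I"
  have bI: "norm (?I \<omega>) \<le> 1" for \<omega> by (auto simp: indicator_def)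
  have b0: "has_bochner_integral M ?I a0"
    unfolding a0_def has_bochner_integral_iff by (auto intro!: integrable_const_bound[where B=1] simp: indicator_def)
  have b1: "has_bochner_integral M (\<lambda>\<omega>. (V 1 \<omega>)\<^sup>2 * ?I \<omega>) a1"
    unfolding a1_def has_bochner_integral_iff
    by (intro conjI refl integrable_mult_bounded[OF _ _ bI] square_integrable_V1_H) measurable
  have b2: "has_bochner_integral M (\<lambda>\<omega>. V 1 \<omega> * H \<omega> * ?I \<omega>) a2"
    unfolding a2_def has_bochner_integral_iff
    by (intro conjI refl integrable_mult_bounded[OF _ _ bI] integrable_mult_square square_integrable_V1_H) measurable
  have b3: "has_bochner_integral M (\<lambda>\<omega>. (H \<omega>)\<^sup>2 * ?I \<omega>) a3"
    unfolding a3_def has_bochner_integral_iff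
    by (intro conjI refl integrable_mult_bounded[OF _ _ bI] square_integrable_V1_H) measurable
  have mm: "expectation (\<lambda>\<omega>. m u \<omega> * m v \<omega> * ?I \<omega>) = (u * v) * a1
      + (u * (6 * v * (1 - v)) + (6 * u * (1 - u)) * v) * a2 + ((6 * u * (1 - u)) * (6 * v * (1 - v))) * a3" for u v
  proof (rule has_bochner_integral_integral_eq)
    have "has_bochner_integral M (\<lambda>\<omega>. (u * v) * ((V 1 \<omega>)\<^sup>2 * ?I \<omega>)
      + (u * (6 * v * (1 - v)) + (6 * u * (1 - u)) * v) * (V 1 \<omega> * H \<omega> * ?I \<omega>)
      + ((6 * u * (1 - u)) * (6 * v * (1 - v))) * ((H \<omega>)\<^sup>2 * ?I \<omega>))
     ((u * v) * a1 + (u * (6 * v * (1 - v)) + (6 * u * (1 - u)) * v) * a2 + ((6 * u * (1 - u)) * (6 * v * (1 - v))) * a3)"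
      by (intro has_bochner_integral_add has_bochner_integral_mult_right b1 b2 b3)
    moreover have "(u * v) * ((V 1 \<omega>)\<^sup>2 * ?I \<omega>)
      + (u * (6 * v * (1 - v)) + (6 * u * (1 - u)) * v) * (V 1 \<omega> * H \<omega> * ?I \<omega>)
      + ((6 * u * (1 - u)) * (6 * v * (1 - v))) * ((H \<omega>)\<^sup>2 * ?I \<omega>) = m u \<omega> * m v \<omega> * ?I \<omega>" for \<omega>
      unfolding m_def power2_eq_square by (simp only: ring_distribs mult_ac add_ac)
    ultimately show "has_bochner_integral M (\<lambda>\<omega>. m u \<omega> * m v \<omega> * ?I \<omega>)
     ((u * v) * a1 + (u * (6 * v * (1 - v)) + (6 * u * (1 - u)) * v) * a2 + ((6 * u * (1 - u)) * (6 * v * (1 - v))) * a3)"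
      by (simp only:)
  qed
  let ?K = "\<lambda>p. K (fst p) (snd p)"
  have "(\<integral>\<omega>. (\<integral>p. ?f p \<omega> \<partial>(unif01 \<Otimes>\<^sub>M unif01)) \<partial>M) = (\<integral>p. (\<integral>\<omega>. ?f p \<omega> \<partial>M) \<partial>(unif01 \<Otimes>\<^sub>M unif01))"
    by (rule P.Fubini_integral[OF DD])
  also have "\<dots> = (\<integral>p. (4 * a1) * ((fst p * snd p) * ?K p)
      + (4 * a2) * ((fst p * (6 * snd p * (1 - snd p)) + (6 * fst p * (1 - fst p)) * snd p) * ?K p)
      + (4 * a3) * (((6 * fst p * (1 - fst p)) * (6 * snd p * (1 - snd p))) * ?K p)
      + (2 * a0) * (?K p)\<^sup>2 \<partial>(unif01 \<Otimes>\<^sub>M unif01))"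
  proof (rule integral_cong_AE)
    show "AE p in unif01 \<Otimes>\<^sub>M unif01. (\<integral>\<omega>. ?f p \<omega> \<partial>M) = (4 * a1) * ((fst p * snd p) * ?K p)
      + (4 * a2) * ((fst p * (6 * snd p * (1 - snd p)) + (6 * fst p * (1 - fst p)) * snd p) * ?K p)
      + (4 * a3) * (((6 * fst p * (1 - fst p)) * (6 * snd p * (1 - snd p))) * ?K p)
      + (2 * a0) * (?K p)\<^sup>2"
      using AE_unit_square
    proof eventually_elim
      case (elim p)
      then have "(\<integral>\<omega>. ?f p \<omega> \<partial>M) = expectation (\<lambda>\<omega>. m (fst p) \<omega> * m (snd p) \<omega> * ?I \<omega>) * (4 * ?K p) + expectation ?I * (2 * (?K p)\<^sup>2)"
        by (intro has_bochner_integral_integral_eq conditional_second_moment B) auto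
      then show ?case unfolding mm a0_def[symmetric] by (simp only: ring_distribs mult_ac)
    qed
  qed measurable
  also have "\<dots> = (4 * a1) * (1 / 720) + (4 * a2) * 0 + (4 * a3) * (1 / 700) + (2 * a0) * (11 / 12600)"
    by (intro has_bochner_integral_integral_eq has_bochner_integral_add has_bochner_integral_mult_right square_integrals)
  also have "\<dots> = 11 / 6300 * a0 + 1 / 180 * a1 + 1 / 175 * a3" by simp
  also have "\<dots> = expectation (\<lambda>\<omega>. 11 / 6300 * ?I \<omega> + 1 / 180 * ((V 1 \<omega>)\<^sup>2 * ?I \<omega>) + 1 / 175 * ((H \<omega>)\<^sup>2 * ?I \<omega>))"
    by (intro has_bochner_integral_integral_eq[symmetric] has_bochner_integral_add has_bochner_integral_mult_right b0 b1 b3)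
  also have "\<dots> = expectation (\<lambda>\<omega>. (11 / 6300 + 1 / 180 * (V 1 \<omega>)\<^sup>2 + 1 / 175 * (H \<omega>)\<^sup>2) * ?I \<omega>)"
    by (simp only: ring_distribs mult.assoc)
  finally show ?thesis using L by (simp only:)
qed

lemma residual_integral:
  assumes B[measurable]: "B \<in> sets (borel \<Otimes>\<^sub>M borel)"
  shows "has_bochner_integral M (\<lambda>\<omega>. (Q \<omega> - G \<omega>) * indicator B (V 1 \<omega>, H \<omega>)) 0"
proof -
  interpret P: pair_prob_space unif01 M ..
  let ?I = "\<lambda>\<omega>. indicator B (V 1 \<omega>, H \<omega>) :: real"
  let ?f = "\<lambda>(u, \<omega>). D u \<omega> * ?I \<omega>"
  let ?s = "\<lambda>u. (u\<^sup>2 + (6 * u * (1 - u))\<^sup>2 / 12) * (4 * K u u) + 2 * (K u u)\<^sup>2"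
  have int: "integrable (unif01 \<Otimes>\<^sub>M M) ?f"
  proof (rule P.integrable_pair_if_bounded_fibres)
    show "?f \<in> borel_measurable (unif01 \<Otimes>\<^sub>M M)" by measurable
    have "integrable (unif01 \<Otimes>\<^sub>M unif01) (\<lambda>p. 1 + ?s (fst p))"
      by (intro integrable_unit_square continuous_intros continuous_on_K_diag) auto
    from square.integrable_fst'[OF this] show "integrable unif01 (\<lambda>u. 1 + ?s u)"
      using unif01.prob_space by simp
    show "AE u in unif01. integrable M (\<lambda>\<omega>. ?f (u, \<omega>)) \<and> (\<integral>\<omega>. norm (?f (u, \<omega>)) \<partial>M) \<le> 1 + ?s u"
      using AE_unif01_unit
    proof eventually_elim
      case (elim u)
      then have u: "u \<in> {0..1}" by auto
      have s: "has_bochner_integral M (\<lambda>\<omega>. 1 + (D u \<omega>)\<^sup>2) (1 + ?s u)"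
        by (intro has_bochner_integral_add D_second_moment u) (simp add: has_bochner_integral_iff prob_space)
      have i: "integrable M (\<lambda>\<omega>. ?f (u, \<omega>))"
        using conditional_first_moment[OF u B] by (auto simp: has_bochner_integral_iff)
      have "(\<integral>\<omega>. norm (?f (u, \<omega>)) \<partial>M) \<le> (\<integral>\<omega>. 1 + (D u \<omega>)\<^sup>2 \<partial>M)"
      proof (rule integral_mono)
        show "integrable M (\<lambda>\<omega>. norm (?f (u, \<omega>)))" using i by (rule integrable_norm)
        show "integrable M (\<lambda>\<omega>. 1 + (D u \<omega>)\<^sup>2)" using s by (simp only: has_bochner_integral_iff)
        fix \<omega>
        have "2 * \<bar>D u \<omega>\<bar> \<le> 1 + (D u \<omega>)\<^sup>2"
          using sum_squares_bound[of 1 "\<bar>D u \<omega>\<bar>"] by simp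
        then show "norm (?f (u, \<omega>)) \<le> 1 + (D u \<omega>)\<^sup>2"
          by (auto simp: indicator_def)
      qed
      also have "\<dots> = 1 + ?s u" by (rule has_bochner_integral_integral_eq[OF s])
      finally show ?case using i by blast
    qed
  qed
  have eq: "(\<integral>u. D u \<omega> * ?I \<omega> \<partial>unif01) = (Q \<omega> - G \<omega>) * ?I \<omega>" if "\<omega> \<in> space M" for \<omega>
    using has_bochner_integral_integral_eq[OF integral_D[OF that]] by simp
  have "integrable M (\<lambda>\<omega>. (Q \<omega> - G \<omega>) * ?I \<omega>) \<longleftrightarrow> integrable M (\<lambda>\<omega>. \<integral>u. D u \<omega> * ?I \<omega> \<partial>unif01)"
    by (intro Bochner_Integration.integrable_cong refl eq[symmetric])
  then have "integrable M (\<lambda>\<omega>. (Q \<omega> - G \<omega>) * ?I \<omega>)"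
    using P.integrable_snd[OF int] by blast
  moreover have "(\<integral>\<omega>. (Q \<omega> - G \<omega>) * ?I \<omega> \<partial>M) = (\<integral>\<omega>. (\<integral>u. D u \<omega> * ?I \<omega> \<partial>unif01) \<partial>M)"
    by (intro Bochner_Integration.integral_cong refl eq[symmetric])
  moreover have "\<dots> = (\<integral>u. (\<integral>\<omega>. D u \<omega> * ?I \<omega> \<partial>M) \<partial>unif01)"
    by (rule P.Fubini_integral[OF int])
  moreover have "\<dots> = 0"
  proof (rule integral_eq_zero_AE)
    show "AE u in unif01. (\<integral>\<omega>. D u \<omega> * ?I \<omega> \<partial>M) = 0"
      using AE_unif01_unit
      by eventually_elim (auto intro!: has_bochner_integral_integral_eq conditional_first_moment)
  qed
  ultimately show ?thesis by (simp add: has_bochner_integral_iff)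
qed

text \<open>
  The area and the bridge area differ by half of the end point. Conditioning on the end point and the area
  therefore amounts to testing against indicators of Borel sets of the end point and the bridge area.
\<close>

lemma sigma_V1_S:
  defines "F \<equiv> sigma_gen2 M (V 1) S"
  shows "subalgebra M F"
    and "V 1 \<in> borel_measurable F" "H \<in> borel_measurable F"
    and "C \<in> sets F \<Longrightarrow> \<exists>B \<in> sets (borel \<Otimes>\<^sub>M borel). \<forall>\<omega> \<in> space M. indicator C \<omega> = (indicator B (V 1 \<omega>, H \<omega>) :: real)"
proof -
  let ?Y = "\<lambda>\<omega>. (V 1 \<omega>, S \<omega>)"
  have sets_F: "sets F = {?Y -` A \<inter> space M | A. A \<in> sets (borel \<Otimes>\<^sub>M borel)}"
    unfolding F_def sigma_gen2_def by (rule sets_vimage_algebra2) (simp add: space_pair_measure)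
  have "?Y \<in> M \<rightarrow>\<^sub>M borel \<Otimes>\<^sub>M borel" by measurable
  then show "subalgebra M F"
    unfolding subalgebra_def sets_F by (auto simp: F_def sigma_gen2_def intro: measurable_sets)
  have "?Y \<in> F \<rightarrow>\<^sub>M borel \<Otimes>\<^sub>M borel"
    unfolding F_def sigma_gen2_def by (rule measurable_vimage_algebra1) (simp add: space_pair_measure)
  from measurable_compose[OF this measurable_fst] measurable_compose[OF this measurable_snd]
  have [measurable]: "V 1 \<in> borel_measurable F" "S \<in> borel_measurable F" by simp_all
  then show "V 1 \<in> borel_measurable F" by simp
  show "H \<in> borel_measurable F" unfolding H_def by measurable
  assume "C \<in> sets F"
  then obtain A where [measurable]: "A \<in> sets (borel \<Otimes>\<^sub>M borel)" and C: "C = ?Y -` A \<inter> space M"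
    unfolding sets_F by blast
  define B where "B = (\<lambda>p::real \<times> real. (fst p, snd p + fst p / 2)) -` A \<inter> space (borel \<Otimes>\<^sub>M borel)"
  have "B \<in> sets (borel \<Otimes>\<^sub>M borel)" unfolding B_def by measurable
  moreover have "\<forall>\<omega> \<in> space M. indicator C \<omega> = (indicator B (V 1 \<omega>, H \<omega>) :: real)"
    by (auto simp: C B_def H_def indicator_def space_pair_measure)
  ultimately show "\<exists>B \<in> sets (borel \<Otimes>\<^sub>M borel). \<forall>\<omega> \<in> space M. indicator C \<omega> = (indicator B (V 1 \<omega>, H \<omega>) :: real)"
    by blast
qed

lemma real_cond_exp_V1_S_eqI:
  assumes B: "\<And>B. B \<in> sets (borel \<Otimes>\<^sub>M borel) \<Longrightarrow>
      expectation (\<lambda>\<omega>. f \<omega> * indicator B (V 1 \<omega>, H \<omega>)) = expectation (\<lambda>\<omega>. g \<omega> * indicator B (V 1 \<omega>, H \<omega>))"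
    and "integrable M f" "integrable M g" "g \<in> borel_measurable (sigma_gen2 M (V 1) S)"
  shows "AE \<omega> in M. real_cond_exp M (sigma_gen2 M (V 1) S) f \<omega> = g \<omega>"
proof -
  let ?F = "sigma_gen2 M (V 1) S"
  interpret finite_measure_subalgebra M ?F
    by unfold_locales (rule sigma_V1_S(1))
  show ?thesis
  proof (rule real_cond_exp_charact)
    fix C assume "C \<in> sets ?F"
    from sigma_V1_S(4)[OF this] obtain B where [measurable]: "B \<in> sets (borel \<Otimes>\<^sub>M borel)"
      and C: "\<And>\<omega>. \<omega> \<in> space M \<Longrightarrow> indicator C \<omega> = (indicator B (V 1 \<omega>, H \<omega>) :: real)"
      by blast
    have *: "(\<integral>\<omega>\<in>C. h \<omega> \<partial>M) = expectation (\<lambda>\<omega>. h \<omega> * indicator B (V 1 \<omega>, H \<omega>))" for h :: "'a \<Rightarrow> real"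
      unfolding set_lebesgue_integral_def
      by (intro Bochner_Integration.integral_cong refl) (simp add: C)
    show "(\<integral>\<omega>\<in>C. f \<omega> \<partial>M) = (\<integral>\<omega>\<in>C. g \<omega> \<partial>M)" unfolding * by (rule B) measurable
  qed (use assms in auto)
qed

lemma cond_exp_Q: "AE \<omega> in M. real_cond_exp M (sigma_gen2 M (V 1) S) Q \<omega> = G \<omega>"
proof (rule real_cond_exp_V1_S_eqI)
  have QG: "integrable M (\<lambda>\<omega>. Q \<omega> - G \<omega>)"
    using residual_integral[OF UNIV_in_sets_borel_pair] by (simp add: has_bochner_integral_iff)
  from Bochner_Integration.integrable_add[OF QG G_integrable] show Q: "integrable M Q" by simp
  show "integrable M G" by (rule G_integrable)
  show "G \<in> borel_measurable (sigma_gen2 M (V 1) S)"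
    using sigma_V1_S(2,3) unfolding G_def by measurable
  fix B :: "(real \<times> real) set" assume [measurable]: "B \<in> sets (borel \<Otimes>\<^sub>M borel)"
  have bI: "norm (indicator B (V 1 \<omega>, H \<omega>) :: real) \<le> 1" for \<omega> by (auto simp: indicator_def)
  have "expectation (\<lambda>\<omega>. Q \<omega> * indicator B (V 1 \<omega>, H \<omega>) - G \<omega> * indicator B (V 1 \<omega>, H \<omega>)) = 0"
    using has_bochner_integral_integral_eq[OF residual_integral[of B]] by (simp add: left_diff_distrib)
  moreover have "integrable M (\<lambda>\<omega>. h \<omega> * indicator B (V 1 \<omega>, H \<omega>))" if "integrable M h" for h :: "'a \<Rightarrow> real"
    by (rule integrable_mult_bounded[OF that _ bI]) measurable
  ultimately show "expectation (\<lambda>\<omega>. Q \<omega> * indicator B (V 1 \<omega>, H \<omega>)) = expectation (\<lambda>\<omega>. G \<omega> * indicator B (V 1 \<omega>, H \<omega>))"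
    using Q G_integrable by simp
qed

lemma cond_variance_Q:
  "AE \<omega> in M. cond_variance M Q (V 1) S \<omega> = 11 / 6300 + 1 / 180 * (V 1 \<omega>)\<^sup>2 + 1 / 175 * (H \<omega>)\<^sup>2"
proof -
  let ?F = "sigma_gen2 M (V 1) S"
  let ?g = "\<lambda>\<omega>. 11 / 6300 + 1 / 180 * (V 1 \<omega>)\<^sup>2 + 1 / 175 * (H \<omega>)\<^sup>2"
  interpret finite_measure_subalgebra M ?F
    by unfold_locales (rule sigma_V1_S(1))
  have "AE \<omega> in M. cond_variance M Q (V 1) S \<omega> = real_cond_exp M ?F (\<lambda>\<omega>. (Q \<omega> - G \<omega>)\<^sup>2) \<omega>"
    unfolding cond_variance_def
  proof (rule real_cond_exp_cong)
    show "AE \<omega> in M. (Q \<omega> - real_cond_exp M ?F Q \<omega>)\<^sup>2 = (Q \<omega> - G \<omega>)\<^sup>2"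
      using cond_exp_Q by eventually_elim simp
  qed measurable
  moreover have "AE \<omega> in M. real_cond_exp M ?F (\<lambda>\<omega>. (Q \<omega> - G \<omega>)\<^sup>2) \<omega> = ?g \<omega>"
  proof (rule real_cond_exp_V1_S_eqI)
    show "expectation (\<lambda>\<omega>. (Q \<omega> - G \<omega>)\<^sup>2 * indicator B (V 1 \<omega>, H \<omega>)) = expectation (\<lambda>\<omega>. ?g \<omega> * indicator B (V 1 \<omega>, H \<omega>))"
      if "B \<in> sets (borel \<Otimes>\<^sub>M borel)" for B
      by (rule has_bochner_integral_integral_eq[OF residual_square_integral[OF that]])
    show "integrable M (\<lambda>\<omega>. (Q \<omega> - G \<omega>)\<^sup>2)"
      using residual_square_integral[OF UNIV_in_sets_borel_pair] by (simp add: has_bochner_integral_iff)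
    show "integrable M ?g"
      by (intro Bochner_Integration.integrable_add integrable_mult_right square_integrable_V1_H) simp
    show "?g \<in> borel_measurable ?F"
      using sigma_V1_S(2,3) by measurable
  qed
  ultimately show ?thesis by eventually_elim simp
qed

end

theorem theorem1p3:
  fixes M :: "'a measure" and W :: "real \<Rightarrow> 'a \<Rightarrow> real"
  assumes "standard_brownian_motion M W"
  shows "AE \<omega> in M.
    cond_variance M
      (\<lambda>\<omega>. LBINT u:{0..1}. (W u \<omega>)\<^sup>2)
      (W 1)
      (\<lambda>\<omega>. LBINT u:{0..1}. W u \<omega>) \<omega>
    = 11 / 6300 + 1 / 180 * (W 1 \<omega>)\<^sup>2
      + 1 / 175 * ((LBINT u:{0..1}. W u \<omega>) - 1 / 2 * W 1 \<omega>)\<^sup>2"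
proof -
  interpret standard_brownian_motion M W by (rule assms)
  let ?Q = "\<lambda>\<omega>. LBINT u:{0..1}. (W u \<omega>)\<^sup>2" and ?S = "\<lambda>\<omega>. LBINT u:{0..1}. W u \<omega>"
  let ?F = "sigma_gen2 M (V 1) S"
  have W1: "W 1 = V 1" by (simp add: V_eq)
  \<comment> \<open>Off the sample space the integrals of W and of its extension may differ, but the sigma-algebra does not see this.\<close>
  have F: "sigma_gen2 M (W 1) ?S = ?F"
    unfolding sigma_gen2_def W1 by (intro vimage_algebra_cong refl) (simp add: S_eq)
  interpret finite_measure_subalgebra M ?F
    by unfold_locales (rule sigma_V1_S(1))
  have [measurable]: "?Q \<in> borel_measurable M"
    using Q_measurable by (rule measurable_cong[THEN iffD1, rotated]) (simp add: Q_eq)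
  have "AE \<omega> in M. real_cond_exp M ?F ?Q \<omega> = real_cond_exp M ?F Q \<omega>"
    by (rule real_cond_exp_cong) (auto simp: Q_eq)
  then have "AE \<omega> in M. (?Q \<omega> - real_cond_exp M ?F ?Q \<omega>)\<^sup>2 = (Q \<omega> - real_cond_exp M ?F Q \<omega>)\<^sup>2"
    using AE_space by eventually_elim (simp add: Q_eq)
  then have "AE \<omega> in M. cond_variance M ?Q (W 1) ?S \<omega> = cond_variance M Q (V 1) S \<omega>"
    unfolding cond_variance_def F by (rule real_cond_exp_cong) measurable
  with cond_variance_Q AE_space show ?thesis
    by eventually_elim (simp add: S_eq H_def W1)
qed

end
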